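(* Let $\mathbf{A}\in\mathbb{H}^{m\times n}$ and $\mathbf{W}\in\mathbb{H}^{n\times m}$ be such that $\mathbf{A}\mathbf{W}=\mathbf{V}\in\mathbb{H}^{m\times m}$ is Hermitian, let $k=\max\{\mathrm{Ind}(\mathbf{A}\mathbf{W}),\mathrm{Ind}(\mathbf{W}\mathbf{A})\}$ and $\operatorname{rank}(\mathbf{A}\mathbf{W})^{k+1}=\operatorname{rank}(\mathbf{A}\mathbf{W})^{k}=r$. Then the W-weighted Drazin inverse $\mathbf{A}_{d,\mathbf{W}}=(a_{ij}^{d,\mathbf{W}})\in\mathbb{H}^{m\times n}$ of $\mathbf{A}$ with respect to $\mathbf{W}$ possesses the determinantal representation $$a_{ij}^{d,\mathbf{W}}=\frac{\displaystyle\sum_{\beta\in J_{r,m}\{i\}}\mathrm{cdet}_{i}\left(\left((\mathbf{A}\mathbf{W})^{k+2}\right)_{.i}\left(\bar{\mathbf{v}}_{.j}^{(k)}\right)\right)_{\beta}^{\beta}}{\displaystyle\sum_{\beta\in J_{r,m}}\left|\left((\mathbf{A}\mathbf{W})^{k+2}\right)_{\beta}^{\beta}\right|}$$ for all $i=1,\dots,m$ and $j=1,\dots,n$, where $\bar{\mathbf{v}}_{.j}^{(k)}$ is the $j$th column of $\bar{\mathbf{V}}^{k}:=(\mathbf{A}\mathbf{W})^{k}\mathbf{A}\in\mathbb{H}^{m\times n}$ for $j=1,\dots,n$.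
   Context: $\mathbb{H}$ is the skew field of real quaternions, $\mathbb{H}^{m\times n}$ the $m\times n$ matrices over $\mathbb{H}$, $\mathbf{M}^{*}$ the conjugate transpose; $\mathbf{M}$ is Hermitian if $\mathbf{M}^{*}=\mathbf{M}$. Rank is the dimension of the right column space. For square $\mathbf{M}$, $\mathrm{Ind}(\mathbf{M})$ is the smallest nonnegative integer $k$ with $\operatorname{rank}\mathbf{M}^{k+1}=\operatorname{rank}\mathbf{M}^{k}$. W-weighted Drazin inverse: with $k=\max\{\mathrm{Ind}(\mathbf{A}\mathbf{W}),\mathrm{Ind}(\mathbf{W}\mathbf{A})\}$, $\mathbf{A}_{d,\mathbf{W}}$ is the unique $\mathbf{X}\in\mathbb{H}^{m\times n}$ with $(\mathbf{A}\mathbf{W})^{k+1}\mathbf{X}\mathbf{W}=(\mathbf{A}\mathbf{W})^{k}$, $\mathbf{X}\mathbf{W}\mathbf{A}\mathbf{W}\mathbf{X}=\mathbf{X}$, $\mathbf{A}\mathbf{W}\mathbf{X}=\mathbf{X}\mathbf{W}\mathbf{A}$. Row determinant: for $\mathbf{M}=(m_{pq})\in\mathbb{H}^{n\times n}$ and $1\le i\le n$, $$\mathrm{rdet}_{i}\mathbf{M}=\sum_{\sigma\in S_{n}}(-1)^{n-\rho}\,m_{i\,i_{k_1}}m_{i_{k_1}i_{k_1+1}}\cdots m_{i_{k_1+l_1}\,i}\cdots m_{i_{k_\rho}i_{k_\rho+1}}\cdots m_{i_{k_\rho+l_\rho}i_{k_\rho}},$$ where $\sigma=(i\,i_{k_1}i_{k_1+1}\dots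 i_{k_1+l_1})(i_{k_2}i_{k_2+1}\dots i_{k_2+l_2})\cdots(i_{k_\rho}i_{k_\rho+1}\dots i_{k_\rho+l_\rho})$ is written as a product of its $\rho$ disjoint cycles (fixed points included), the first cycle starts with $i$, each other cycle starts with its smallest element, and $i_{k_2}<i_{k_3}<\dots<i_{k_\rho}$. Column determinant: for $1\le j\le n$, $$\mathrm{cdet}_{j}\mathbf{M}=\sum_{\tau\in S_{n}}(-1)^{n-\rho}\,m_{j_{k_\rho}j_{k_\rho+l_\rho}}\cdots m_{j_{k_\rho+1}j_{k_\rho}}\cdots m_{j\,j_{k_1+l_1}}\cdots m_{j_{k_1+1}j_{k_1}}m_{j_{k_1}j},$$ where $\tau=(j_{k_\rho+l_\rho}\dots j_{k_\rho+1}j_{k_\rho})\cdots(j_{k_2+l_2}\dots j_{k_2+1}j_{k_2})(j_{k_1+l_1}\dots j_{k_1+1}j_{k_1}j)$, with $\rho$ the number of disjoint cycles (fixed points included), the last cycle ends with $j$, each other cycle ends with its smallest element, and $j_{k_2}<\dots<j_{k_\rho}$. For Hermitian $\mathbf{M}$ all $\mathrm{rdet}_i\mathbf{M}$ and $\mathrm{cdet}_j\mathbf{M}$ coincide and are real; this common value is $\det\mathbf{M}$. Notation: $\mathbf{M}_{.i}(\mathbf{b})$ is $\mathbf{M}$ with its $i$th column replaced by the column $\mathbf{b}$. $\mathbf{M}_{\beta}^{\beta}$ is the principal submatrix with rows and columns indexed by $\beta$; $|\mathbf{M}_{\beta}^{\beta}|$ is its determinant when $\mathbf{M}$ is Hermitian.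 For $i\in\beta$, $\mathrm{cdet}_i$ of a principal submatrix indexed by $\beta$ is taken along the column with original index $i$. $J_{r,m}$ is the set of strictly increasing sequences (equivalently subsets) $\beta$ of $r$ elements of $\{1,\dots,m\}$, and $J_{r,m}\{i\}=\{\beta\in J_{r,m}: i\in\beta\}$; these are defined for $1\le r\le m$, so $r\ge1$ is implicit. *)

theory Defs
  imports
    Complex_Main
    "HOL-Combinatorics.Cycles"
    "Jordan_Normal_Form.DL_Submatrix"
    "Jordan_Normal_Form.Determinant"
    "Jordan_Normal_Form.Conjugate"
begin

section \<open>Real quaternions\<close>

datatype quat = Quat (qre: real) (qi: real) (qj: real) (qk: real)

instantiation quat :: division_ring
begin

definition zero_quat :: quat where "0 = Quat 0 0 0 0"

definition one_quat :: quat where "1 = Quat 1 0 0 0"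

definition plus_quat :: "quat \<Rightarrow> quat \<Rightarrow> quat" where
  "p + q = Quat (qre p + qre q) (qi p + qi q) (qj p + qj q) (qk p + qk q)"

definition uminus_quat :: "quat \<Rightarrow> quat" where
  "- p = Quat (- qre p) (- qi p) (- qj p) (- qk p)"

definition minus_quat :: "quat \<Rightarrow> quat \<Rightarrow> quat" where
  "p - q = Quat (qre p - qre q) (qi p - qi q) (qj p - qj q) (qk p - qk q)"

definition times_quat :: "quat \<Rightarrow> quat \<Rightarrow> quat" where
  "p * q = Quat
     (qre p * qre q - qi p * qi q - qj p * qj q - qk p * qk q)
     (qre p * qi q + qi p * qre q + qj p * qk q - qk p * qj q)
     (qre p * qj q - qi p * qk q + qj p * qre q + qk p * qi q)
     (qre p * qk q + qi p * qj q - qj p * qi q + qk p * qre q)"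

definition inverse_quat :: "quat \<Rightarrow> quat" where
  "inverse p =
     (let N = (qre p)\<^sup>2 + (qi p)\<^sup>2 + (qj p)\<^sup>2 + (qk p)\<^sup>2
      in Quat (qre p / N) (- qi p / N) (- qj p / N) (- qk p / N))"

definition divide_quat :: "quat \<Rightarrow> quat \<Rightarrow> quat" where
  "p div q = p * inverse (q :: quat)"

lemma quat_norm_pos:
  fixes p :: quat
  assumes "p \<noteq> 0"
  shows "(qre p)\<^sup>2 + (qi p)\<^sup>2 + (qj p)\<^sup>2 + (qk p)\<^sup>2 > 0"
proof -
  have "qre p \<noteq> 0 \<or> qi p \<noteq> 0 \<or> qj p \<noteq> 0 \<or> qk p \<noteq> 0"
    using assms by (cases p) (auto simp: zero_quat_def)
  then show ?thesis
    by (auto intro: add_pos_nonneg add_nonneg_pos simp: add_nonneg_pos add_pos_nonneg)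
qed

instance
proof
  fix p q r :: quat
  show "p + q + r = p + (q + r)" "p + q = q + p" "0 + p = p" "- p + p = 0" "p - q = p + - q"
    by (cases p; cases q; cases r; simp add: plus_quat_def zero_quat_def uminus_quat_def minus_quat_def)+
  show "p * q * r = p * (q * r)"
    by (simp add: times_quat_def algebra_simps)
  show "(p + q) * r = p * r + q * r" "p * (q + r) = p * q + p * r"
    by (simp_all add: times_quat_def plus_quat_def algebra_simps)
  show "1 * p = p" "p * 1 = p"
    by (cases p; simp add: times_quat_def one_quat_def)+
  show "(0 :: quat) \<noteq> 1"
    by (simp add: zero_quat_def one_quat_def)
  show "p div q = p * inverse q"
    by (simp add: divide_quat_def)
  show "inverse (0 :: quat) = 0"
    by (simp add: inverse_quat_def zero_quat_def)
  assume "p \<noteq> 0"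
  from quat_norm_pos[OF this]
  have N: "(qre p)\<^sup>2 + (qi p)\<^sup>2 + (qj p)\<^sup>2 + (qk p)\<^sup>2 \<noteq> 0"
    by simp
  have N': "qre p * qre p / N + qi p * qi p / N + qj p * qj p / N + qk p * qk p / N = 1"
    if "N = (qre p)\<^sup>2 + (qi p)\<^sup>2 + (qj p)\<^sup>2 + (qk p)\<^sup>2" for N
    using N that by (simp add: power2_eq_square flip: add_divide_distrib)
  show "inverse p * p = 1" "p * inverse p = 1"
    using N'[OF refl]
    by (simp_all add: times_quat_def one_quat_def inverse_quat_def Let_def mult.commute)
qed

end

instantiation quat :: conjugate
begin

definition conjugate_quat :: "quat \<Rightarrow> quat" where
  "conjugate p = Quat (qre p) (- qi p) (- qj p) (- qk p)"

instance
  by standard (auto simp: conjugate_quat_def quat.expand)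

end

section \<open>Hermitian matrices, rank and index\<close>

definition conj_transpose :: "'a :: conjugate mat \<Rightarrow> 'a mat" where
  "conj_transpose M = map_mat conjugate (transpose_mat M)"

definition hermitian_mat :: "'a :: conjugate mat \<Rightarrow> bool" where
  "hermitian_mat M \<longleftrightarrow> conj_transpose M = M"

text \<open>The entries of a vector \<open>c\<close> act on the columns of \<open>M\<close> from the right in \<open>M *\<^sub>v c\<close>, so
  \<open>M *\<^sub>v c\<close> is a right linear combination of the columns of \<open>M\<close>. The vector space theory of
  the library is restricted to fields, hence bases and dimension are introduced here.\<close>

definition right_col_space :: "'a :: division_ring mat \<Rightarrow> 'a vec set" where
  "right_col_space M = {M *\<^sub>v c | c. c \<in> carrier_vec (dim_col M)}"

definition right_indep :: "nat \<Rightarrow> 'a :: division_ring vec list \<Rightarrow> bool" where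
  "right_indep n bs \<longleftrightarrow>
     (\<forall>c \<in> carrier_vec (length bs). mat_of_cols n bs *\<^sub>v c = 0\<^sub>v n \<longrightarrow> c = 0\<^sub>v (length bs))"

definition right_basis :: "nat \<Rightarrow> 'a :: division_ring vec set \<Rightarrow> 'a vec list \<Rightarrow> bool" where
  "right_basis n U bs \<longleftrightarrow>
     set bs \<subseteq> carrier_vec n \<and> right_indep n bs \<and> right_col_space (mat_of_cols n bs) = U"

definition right_dim :: "nat \<Rightarrow> 'a :: division_ring vec set \<Rightarrow> nat" where
  "right_dim n U = (THE d. \<exists>bs. right_basis n U bs \<and> length bs = d)"

definition right_rank :: "'a :: division_ring mat \<Rightarrow> nat" where
  "right_rank M = right_dim (dim_row M) (right_col_space M)"

definition mat_index :: "'a :: division_ring mat \<Rightarrow> nat" where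
  "mat_index M = (LEAST k. right_rank (M ^\<^sub>m (k + 1)) = right_rank (M ^\<^sub>m k))"

section \<open>The weighted Drazin inverse\<close>

definition is_wdrazin ::
  "'a :: division_ring mat \<Rightarrow> 'a mat \<Rightarrow> 'a mat \<Rightarrow> bool" where
  "is_wdrazin A W X \<longleftrightarrow>
     (let k = max (mat_index (A * W)) (mat_index (W * A)) in
       X \<in> carrier_mat (dim_row A) (dim_col A) \<and>
       (A * W) ^\<^sub>m (k + 1) * X * W = (A * W) ^\<^sub>m k \<and>
       X * W * A * W * X = X \<and>
       A * W * X = X * W * A)"

definition wdrazin :: "'a :: division_ring mat \<Rightarrow> 'a mat \<Rightarrow> 'a mat" where
  "wdrazin A W = (THE X. is_wdrazin A W X)"

section \<open>Row and column determinants\<close>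

text \<open>Rows and columns are numbered from \<open>0\<close>. The list \<open>support \<sigma> a\<close> is the cycle
  \<open>[a, \<sigma> a, \<sigma> (\<sigma> a), \<dots>]\<close> of \<open>\<sigma>\<close> that starts with \<open>a\<close>, and \<open>cycle_leaders n \<sigma> i\<close> are the smallest
  elements of the cycles that do not contain \<open>i\<close>.\<close>

definition cycle_prod :: "'a :: monoid_mult mat \<Rightarrow> (nat \<Rightarrow> nat) \<Rightarrow> nat \<Rightarrow> 'a" where
  "cycle_prod M \<sigma> a = prod_list (map (\<lambda>x. M $$ (x, \<sigma> x)) (support \<sigma> a))"

definition cycle_leaders :: "nat \<Rightarrow> (nat \<Rightarrow> nat) \<Rightarrow> nat \<Rightarrow> nat set" where
  "cycle_leaders n \<sigma> i =
     {a. a < n \<and> a \<notin> set (support \<sigma> i) \<and> a = Min (set (support \<sigma> a))}"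

definition num_cycles :: "nat \<Rightarrow> (nat \<Rightarrow> nat) \<Rightarrow> nat" where
  "num_cycles n \<sigma> = card ((\<lambda>a. set (support \<sigma> a)) ` {0..<n})"

definition rdet :: "nat \<Rightarrow> 'a :: ring_1 mat \<Rightarrow> 'a" where
  "rdet i M =
     (let n = dim_row M in
       \<Sum>\<sigma> | \<sigma> permutes {0..<n}.
         (-1) ^ (n - num_cycles n \<sigma>) *
         prod_list (map (cycle_prod M \<sigma>) (i # sorted_list_of_set (cycle_leaders n \<sigma> i))))"

text \<open>In the column determinant the cycles are listed in the opposite order, the cycle of \<open>j\<close>
  being the last one. A cycle \<open>(j\<^sub>l \<dots> j\<^sub>1 j\<^sub>0)\<close> of \<open>\<tau>\<close> that ends with its leader \<open>j\<^sub>0\<close> satisfies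
  \<open>\<tau> j\<^sub>0 = j\<^sub>l\<close> and \<open>\<tau> j\<^sub>s = j\<^sub>s\<^sub>-\<^sub>1\<close>. It contributes \<open>m j\<^sub>0 j\<^sub>l * \<dots> * m j\<^sub>2 j\<^sub>1 * m j\<^sub>1 j\<^sub>0\<close>,
  which is again \<open>cycle_prod M \<tau> j\<^sub>0\<close>.\<close>

definition cdet :: "nat \<Rightarrow> 'a :: ring_1 mat \<Rightarrow> 'a" where
  "cdet j M =
     (let n = dim_row M in
       \<Sum>\<tau> | \<tau> permutes {0..<n}.
         (-1) ^ (n - num_cycles n \<tau>) *
         prod_list (map (cycle_prod M \<tau>) (rev (sorted_list_of_set (cycle_leaders n \<tau> j)) @ [j])))"

text \<open>The common value of all row and column determinants; meaningful for Hermitian matrices.\<close>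

definition hdet :: "'a :: ring_1 mat \<Rightarrow> 'a" where
  "hdet M = (THE d. \<forall>i < dim_row M. rdet i M = d \<and> cdet i M = d)"

section \<open>Principal submatrices\<close>

definition index_sets :: "nat \<Rightarrow> nat \<Rightarrow> nat set set" where
  "index_sets r m = {\<beta>. \<beta> \<subseteq> {0..<m} \<and> card \<beta> = r}"

definition index_sets_at :: "nat \<Rightarrow> nat \<Rightarrow> nat \<Rightarrow> nat set set" where
  "index_sets_at r m i = {\<beta> \<in> index_sets r m. i \<in> \<beta>}"

abbreviation principal_submatrix :: "'a mat \<Rightarrow> nat set \<Rightarrow> 'a mat" where
  "principal_submatrix M \<beta> \<equiv> submatrix M \<beta> \<beta>"

text \<open>The library's \<open>submatrix\<close> renumbers rows and columns in increasing order; the original index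
  \<open>i \<in> \<beta>\<close> ends up at position \<open>card {a \<in> \<beta>. a < i}\<close>.\<close>

definition cdet_principal :: "nat \<Rightarrow> 'a :: ring_1 mat \<Rightarrow> nat set \<Rightarrow> 'a" where
  "cdet_principal i M \<beta> = cdet (card {a \<in> \<beta>. a < i}) (principal_submatrix M \<beta>)"

end

theory Submission
  imports Defs
begin

text \<open>The representation is Cramer's rule for a Hermitian matrix of deficient rank.  Put
\<open>V = A W\<close> and \<open>H = V\<^sup>k\<^sup>+\<^sup>2\<close>.  A Hermitian matrix satisfies \<open>ker V\<^sup>2 = ker V\<close>, hence \<open>V\<close> has a
group inverse \<open>Z\<close>, and the weighted Drazin inverse is \<open>X = Z\<^sup>2 A\<close> (\<open>wdrazin_eq\<close>).  Therefore
\<open>H X = V\<^sup>k A\<close>, and the columns of \<open>X\<close> lie in the column space of \<open>H\<close>.  What remains is to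
recover a vector \<open>y\<close> of the column space of \<open>H\<close> from \<open>b = H y\<close>.

Write \<open>d\<^sub>s\<close> for the sum of the principal minors of \<open>H\<close> of size \<open>s\<close>, and \<open>c\<^sub>s(v)\<close> for the sum,
over the index sets \<open>\<beta>\<close> of size \<open>s\<close> that contain \<open>i\<close>, of the column determinants along \<open>i\<close> of
\<open>H\<^sub>\<beta>\<close> with column \<open>i\<close> replaced by \<open>v\<close>.  The identity
\<open>d\<^sub>s y\<^sub>i = c\<^sub>s\<^sub>+\<^sub>1(y) + c\<^sub>s(H y)\<close> (\<open>minor_sum_mult\<close>) is the coefficient of a power of \<open>t\<close> in Cramer's
rule for \<open>t I + H\<close>.  If \<open>r\<close> is the rank of \<open>H\<close>, then \<open>d\<^sub>r \<noteq> 0\<close> and \<open>c\<^sub>r\<^sub>+\<^sub>1\<close> vanishes on the column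
space of \<open>H\<close>, so that \<open>d\<^sub>r y\<^sub>i = c\<^sub>r(b)\<close>, which is the claim.

Two things have to be supplied over the quaternions.  The first is Cramer's rule itself.  All
column determinants of a Hermitian matrix along its different columns agree and are real
(\<open>det_on_eq_walk\<close>), and a column determinant vanishes when its column is replaced by another
column of the matrix (\<open>walk_eq_0\<close>).  Both are read off from the expansion of a column determinant
as a signed sum over paths, whose cofactors are real: since real numbers commute with
everything, the sum over all cycles through a given vertex can be moved through a product, and
cutting a path at a prescribed vertex exhibits terms that cancel or that match up under a cyclic rotation.

The second is the link with the rank.  The coefficients of \<open>c\<^sub>s\<close> form a matrix \<open>adj\<^sub>s\<close> with
\<open>d\<^sub>s I = adj\<^sub>s\<^sub>+\<^sub>1 + adj\<^sub>s H\<close>.  Let \<open>r\<close> be the largest index with \<open>d\<^sub>r \<noteq> 0\<close>.  For \<open>s > r\<close> the recursion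
gives \<open>adj\<^sub>s H\<^sup>t = \<plusminus> adj\<^sub>s\<^sub>+\<^sub>t\<close>, which is zero for large \<open>t\<close>, whence \<open>adj\<^sub>s H = 0\<close> because \<open>H\<close> is Hermitian.
Consequently \<open>adj\<^sub>r / d\<^sub>r\<close> is an inner inverse of \<open>H\<close> that commutes with \<open>H\<close>
(\<open>hermitian_inner_inverse\<close>), and \<open>P = adj\<^sub>r H / d\<^sub>r\<close> is an idempotent with the column space of
\<open>H\<close>.  Taking traces in the recursion shows that the trace of \<open>P\<close> is \<open>r\<close>.  Finally the real part of the
trace of an idempotent is the dimension of its column space
(\<open>right_basis_length_idempotent\<close>), because \<open>Re tr\<close> is invariant under exchanging two
factors.  The same formula yields the uniqueness of the dimension.\<close>

section \<open>Cycles of a permutation\<close>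

lemma funpow_nth_cycle:
  assumes "xs \<noteq> []" "hd xs = a"
    and "\<And>k. Suc k < length xs \<Longrightarrow> p (xs ! k) = xs ! Suc k" "p (last xs) = a"
  shows "(p ^^ k) a = xs ! (k mod length xs)"
proof (induction k)
  case 0 show ?case using assms(1,2) by (simp add: hd_conv_nth)
next
  case (Suc k)
  let ?n = "length xs" and ?j = "k mod length xs"
  have n: "?n > 0" using assms(1) by simp
  show ?case
  proof (cases "Suc ?j = ?n")
    case True
    then have "xs ! ?j = last xs" using assms(1) by (metis diff_Suc_1 last_conv_nth)
    with Suc True show ?thesis using assms(1,2,4) by (simp add: mod_Suc hd_conv_nth)
  next
    case False
    then have "Suc ?j < ?n" using n by (metis Suc_lessI mod_less_divisor)
    with Suc False assms(3) show ?thesis by (simp add: mod_Suc)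
  qed
qed

text \<open>A constant for the cycle of \<open>p\<close> that starts with \<open>a\<close>, so that the iterates of \<open>p\<close> in it stay
folded.\<close>

definition cyc :: "('a \<Rightarrow> 'a) \<Rightarrow> 'a \<Rightarrow> 'a list" where
  "cyc p a = support p a"

text \<open>A list is recognised as the cycle that starts at \<open>a\<close> by local conditions on neighbouring
entries.  This is how the cycles of modified permutations are computed below.\<close>

lemma cyc_eqI:
  assumes "distinct xs" "xs \<noteq> []" "hd xs = a"
    and "\<And>k. Suc k < length xs \<Longrightarrow> p (xs ! k) = xs ! Suc k" "p (last xs) = a"
  shows "cyc p a = xs"
proof -
  let ?n = "length xs"
  have pw: "(p ^^ k) a = xs ! (k mod ?n)" for k
    using funpow_nth_cycle[OF assms(2-5)] .
  have n: "?n > 0" and x0: "xs ! 0 = a" using assms(2,3) by (auto simp: hd_conv_nth)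
  have "least_power p a = ?n" unfolding least_power_def
  proof (rule Least_equality)
    show "(p ^^ ?n) a = a \<and> 0 < ?n" using n x0 by (simp add: pw)
  next
    fix y assume y: "(p ^^ y) a = a \<and> 0 < y"
    show "?n \<le> y"
    proof (rule ccontr)
      assume "\<not> ?n \<le> y"
      then have "xs ! y = xs ! 0" "y < ?n" using y x0 by (simp_all add: pw)
      then show False using y n assms(1) by (simp add: nth_eq_iff_index_eq)
    qed
  qed
  then show ?thesis unfolding cyc_def by (intro nth_equalityI) (auto simp: pw)
qed

lemma set_cyc: "permutation p \<Longrightarrow> set (cyc p a) = range (\<lambda>k. (p ^^ k) a)"
  unfolding cyc_def by (rule support_set)

lemma distinct_cyc: "permutation p \<Longrightarrow> distinct (cyc p a)"
  unfolding cyc_def by (rule cycle_of_permutation)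

lemma cyc_nth_Suc: "Suc k < length (cyc p a) \<Longrightarrow> p (cyc p a ! k) = cyc p a ! Suc k"
  unfolding cyc_def by simp

lemma
  assumes "permutation p"
  shows cyc_ne: "cyc p a \<noteq> []" and hd_cyc: "hd (cyc p a) = a" and in_cyc: "a \<in> set (cyc p a)"
    and last_cyc: "p (last (cyc p a)) = a"
proof -
  note l = least_power_of_permutation[OF assms, of a]
  show ne: "cyc p a \<noteq> []" using l(2) by (simp add: cyc_def)
  show hd: "hd (cyc p a) = a" using l(2) by (simp add: cyc_def hd_map)
  show "a \<in> set (cyc p a)" using hd ne by (metis hd_in_set)
  obtain n where n: "least_power p a = Suc n" using l(2) gr0_implies_Suc by blast
  show "p (last (cyc p a)) = a" using l(1) by (simp add: cyc_def last_map n)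
qed

lemma set_cyc_subset:
  assumes "p permutes S" "a \<in> S" shows "set (cyc p a) \<subseteq> S"
  using permutes_funpow[OF assms(1)] assms(2) by (auto simp: permutes_in_image cyc_def)

lemma disjoint_cyc:
  "permutation p \<Longrightarrow> a \<notin> set (cyc p b) \<Longrightarrow> set (cyc p a) \<inter> set (cyc p b) = {}"
  unfolding cyc_def by (rule disjoint_support'[THEN iffD2])

lemma set_cyc_eq:
  assumes "permutation p" "b \<in> set (cyc p a)"
  shows "set (cyc p b) = set (cyc p a)"
proof (rule ccontr)
  assume "set (cyc p b) \<noteq> set (cyc p a)"
  then have "set (cyc p b) \<inter> set (cyc p a) = {}"
    unfolding cyc_def by (intro disjointD[OF disjoint_support[OF assms(1)]]) auto
  then show False using in_cyc[OF assms(1), of b] assms(2) by blast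
qed

lemma cyc_closed:
  assumes "permutation p" "b \<in> set (cyc p a)"
  shows "p b \<in> set (cyc p a)"
proof -
  obtain k where "b = (p ^^ k) a" using assms(2) set_cyc[OF assms(1)] by auto
  then have "p b = (p ^^ Suc k) a" by simp
  then show ?thesis unfolding set_cyc[OF assms(1)] by blast
qed

section \<open>Removing the last point of a cycle\<close>

definition cycle_weight :: "(nat \<Rightarrow> nat \<Rightarrow> 'a :: monoid_mult) \<Rightarrow> (nat \<Rightarrow> nat) \<Rightarrow> nat \<Rightarrow> 'a" where
  "cycle_weight m p a = prod_list (map (\<lambda>x. m x (p x)) (cyc p a))"

definition leaders :: "nat set \<Rightarrow> (nat \<Rightarrow> nat) \<Rightarrow> nat set" where
  "leaders S p = {a \<in> S. a = Min (set (cyc p a))}"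

definition ncycles :: "nat set \<Rightarrow> (nat \<Rightarrow> nat) \<Rightarrow> nat" where
  "ncycles S p = card ((\<lambda>a. set (cyc p a)) ` S)"

text \<open>The determinant of the submatrix on rows and columns \<open>S\<close>, in which every cycle starts with its
smallest element.  It is the column determinant along the smallest element of \<open>S\<close>
(\<open>perm_det_eq_perm_cdet\<close>), and it is the factor that multiplies the monomials in which \<open>i\<close> is a
fixed point.\<close>

definition perm_det :: "(nat \<Rightarrow> nat \<Rightarrow> 'a :: ring_1) \<Rightarrow> nat set \<Rightarrow> 'a" where
  "perm_det m S = (\<Sum>p | p permutes S. (-1) ^ (card S - ncycles S p) *
     prod_list (map (cycle_weight m p) (rev (sorted_list_of_set (leaders S p)))))"

definition perm_cdet :: "(nat \<Rightarrow> nat \<Rightarrow> 'a :: ring_1) \<Rightarrow> nat set \<Rightarrow> nat \<Rightarrow> 'a" where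
  "perm_cdet m S i = (\<Sum>p | p permutes S. (-1) ^ (card S - ncycles S p) *
     prod_list (map (cycle_weight m p)
       (rev (sorted_list_of_set (leaders S p - set (cyc p i))) @ [i])))"

lemma cdet_eq_perm_cdet: "cdet i M = perm_cdet (\<lambda>x y. M $$ (x, y)) {0..<dim_row M} i"
proof -
  have "cycle_leaders n p i = leaders {0..<n} p - set (cyc p i)" for n p
    unfolding cycle_leaders_def leaders_def cyc_def by auto
  moreover have "cycle_prod M p = cycle_weight (\<lambda>x y. M $$ (x, y)) p" for p
    unfolding cycle_prod_def cycle_weight_def cyc_def by (rule ext) simp
  ultimately show ?thesis
    unfolding cdet_def perm_cdet_def num_cycles_def ncycles_def cyc_def[symmetric] by (simp add: Let_def)
qed

lemma ncycles_le: "finite S \<Longrightarrow> ncycles S p \<le> card S"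
  unfolding ncycles_def by (rule card_image_le)

text \<open>Composing \<open>p\<close> with the transposition of \<open>x\<close> and \<open>i\<close> appends the new point \<open>x\<close> at the end of the
cycle that starts with \<open>i\<close> and leaves all other cycles alone.  Therefore the leaders and the number
of cycles stay the same, the number of points grows by one, and the weight of the cycle of \<open>i\<close> gains
the factor \<open>m x i\<close> on the right, the step into \<open>i\<close> now being taken into \<open>x\<close>.\<close>

context
  fixes p :: "nat \<Rightarrow> nat" and T :: "nat set" and i x :: nat
  fixes q :: "nat \<Rightarrow> nat"
  assumes fin: "finite T" and p: "p permutes insert i T" and x: "x \<notin> insert i T"
    and q: "q = transpose x i \<circ> p"
begin

lemma splice_apply: "q a = (if p a = i then x else if p a = x then i else p a)"
  unfolding q by (simp add: transpose_def)

lemma permutation_unspliced: "permutation p" using p fin by (intro permutes_imp_permutation) auto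

lemma splice_permutes: "q permutes insert x (insert i T)"
proof -
  have "p permutes insert x (insert i T)" using p by (rule permutes_subset) auto
  then show ?thesis unfolding q by (rule permutes_compose) (rule permutes_swap_id; simp)
qed

lemma permutation_splice: "permutation q" using splice_permutes fin by (intro permutes_imp_permutation) auto

lemma cyc_splice: "cyc q i = cyc p i @ [x]"
proof (rule cyc_eqI)
  let ?xs = "cyc p i"
  have sub: "set ?xs \<subseteq> insert i T" by (rule set_cyc_subset[OF p]) simp
  have d: "distinct ?xs" by (rule distinct_cyc[OF permutation_unspliced])
  note s = cyc_ne[OF permutation_unspliced, of i] hd_cyc[OF permutation_unspliced, of i] in_cyc[OF permutation_unspliced, of i]
    cyc_nth_Suc[of _ p i] last_cyc[OF permutation_unspliced, of i]
  show "distinct (?xs @ [x])" using d sub x by auto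
  show "?xs @ [x] \<noteq> []" by simp
  show "hd (?xs @ [x]) = i" using s by simp
  have "p x = x" using p x by (simp add: permutes_def)
  then show "q (last (?xs @ [x])) = i" using x by (simp add: splice_apply)
  fix k assume k: "Suc k < length (?xs @ [x])"
  show "q ((?xs @ [x]) ! k) = (?xs @ [x]) ! Suc k"
  proof (cases "Suc k = length ?xs")
    case True
    then have "?xs ! k = last ?xs" using s(1) by (metis diff_Suc_1 last_conv_nth)
    then show ?thesis using True s(5) by (simp add: nth_append splice_apply)
  next
    case False
    with k have k': "Suc k < length ?xs" by simp
    have pk: "p (?xs ! k) = ?xs ! Suc k" using s(4)[OF k'] .
    have "?xs ! Suc k \<noteq> ?xs ! 0" using d k' by (subst nth_eq_iff_index_eq) auto
    then have 1: "?xs ! Suc k \<noteq> i" using s(1,2) by (metis hd_conv_nth)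
    have "?xs ! Suc k \<in> set ?xs" using k' by (meson nth_mem)
    then have 2: "?xs ! Suc k \<noteq> x" using sub x by blast
    from pk 1 2 k' show ?thesis by (simp add: nth_append splice_apply )
  qed
qed

lemma cyc_splice_other:
  assumes a: "a \<in> T" "a \<notin> set (cyc p i)"
  shows "cyc q a = cyc p a"
proof (rule cyc_eqI)
  let ?xs = "cyc p a"
  have sub: "set ?xs \<subseteq> insert i T" by (rule set_cyc_subset[OF p]) (use a in simp)
  have d: "distinct ?xs" by (rule distinct_cyc[OF permutation_unspliced])
  have "set ?xs \<inter> set (cyc p i) = {}" using disjoint_cyc[OF permutation_unspliced] a(2) by simp
  then have ni: "i \<notin> set ?xs" using in_cyc[OF permutation_unspliced, of i] by blast
  note s = cyc_ne[OF permutation_unspliced, of a] hd_cyc[OF permutation_unspliced, of a] in_cyc[OF permutation_unspliced, of a]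
    cyc_nth_Suc[of _ p a] last_cyc[OF permutation_unspliced, of a]
  show "distinct ?xs" "?xs \<noteq> []" "hd ?xs = a" using d s by auto
  have e: "q b = p b" if "b \<in> set ?xs" for b
  proof -
    have "p b \<in> set ?xs" using cyc_closed[OF permutation_unspliced that] .
    then have "p b \<noteq> i" "p b \<noteq> x" using ni sub x by auto
    then show ?thesis by (simp add: splice_apply)
  qed
  show "q (last ?xs) = a" using e[of "last ?xs"] s(1,5) by simp
  fix k assume k: "Suc k < length ?xs"
  have "?xs ! k \<in> set ?xs" by (rule nth_mem) (use k in simp)
  then show "q (?xs ! k) = ?xs ! Suc k" using e s(4)[OF k] by metis
qed

lemma leaders_splice:
  "leaders (insert x (insert i T)) q - set (cyc q i) = leaders (insert i T) p - set (cyc p i)"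
proof -
  have i: "i \<in> set (cyc p i)" using in_cyc[OF permutation_unspliced] .
  have eq: "set (cyc q a) = set (cyc p a)" if "a \<in> T" "a \<notin> set (cyc p i)" for a
    using cyc_splice_other[OF that] by simp
  have "set (cyc q i) = insert x (set (cyc p i))" using cyc_splice by simp
  moreover have "a \<in> leaders (insert x (insert i T)) q - insert x (set (cyc p i)) \<longleftrightarrow>
      a \<in> leaders (insert i T) p - set (cyc p i)" for a
  proof (cases "a \<in> T \<and> a \<notin> set (cyc p i)")
    case True
    then have "a \<noteq> x" using x by auto
    with True eq[of a] show ?thesis unfolding leaders_def by simp
  next
    case False
    have "a \<notin> leaders (insert x (insert i T)) q - insert x (set (cyc p i))"
      unfolding leaders_def using False i by blast
    moreover have "a \<notin> leaders (insert i T) p - set (cyc p i)"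
      unfolding leaders_def using False i by blast
    ultimately show ?thesis by blast
  qed
  ultimately show ?thesis by blast
qed

lemma ncycles_splice: "ncycles (insert x (insert i T)) q = ncycles (insert i T) p"
proof -
  let ?c = "\<lambda>r a. set (cyc r a)"
  let ?R = "?c p ` (T - ?c p i)"
  have i: "i \<in> ?c p i" using in_cyc[OF permutation_unspliced] .
  have ci: "?c q i = insert x (?c p i)" using cyc_splice by simp
  have sub: "?c p i \<subseteq> insert i T" by (rule set_cyc_subset[OF p]) simp
  have eq: "?c q a = ?c p a" if "a \<in> T - ?c p i" for a
    using cyc_splice_other that by simp
  have "insert x (insert i T) = ?c q i \<union> (T - ?c p i)" unfolding ci using sub i by auto
  then have "?c q ` insert x (insert i T) = ?c q ` ?c q i \<union> ?c q ` (T - ?c p i)"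
    by (metis image_Un)
  also have "?c q ` ?c q i = {?c q i}"
    using set_cyc_eq[OF permutation_splice, where a = i] in_cyc[OF permutation_splice, of i] by blast
  also have "?c q ` (T - ?c p i) = ?R" using eq by (rule image_cong[OF refl])
  finally have 1: "?c q ` insert x (insert i T) = insert (?c q i) ?R" by simp
  have "insert i T = ?c p i \<union> (T - ?c p i)" using sub i by auto
  then have "?c p ` insert i T = ?c p ` ?c p i \<union> ?R" by (metis image_Un)
  also have "?c p ` ?c p i = {?c p i}"
    using set_cyc_eq[OF permutation_unspliced, where a = i] i by blast
  finally have 2: "?c p ` insert i T = insert (?c p i) ?R" by simp
  have "i \<notin> ?c p a" if "a \<in> T - ?c p i" for a
    using disjoint_cyc[OF permutation_unspliced, of a i] that i by blast
  then have "?c p i \<notin> ?R" "?c q i \<notin> ?R" using i ci by auto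
  then show ?thesis unfolding ncycles_def 1 2 using fin by simp
qed

lemma cycle_weight_splice:
  "cycle_weight m q i = cycle_weight (\<lambda>a b. if b = i then m a x else m a b) p i * m x i"
proof -
  have "p x = x" using p x by (simp add: permutes_def)
  then have sx: "q x = i" using x by (simp add: splice_apply)
  have sub: "set (cyc p i) \<subseteq> insert i T" by (rule set_cyc_subset[OF p]) simp
  have "m a (q a) = (if p a = i then m a x else m a (p a))" if "a \<in> set (cyc p i)" for a
  proof -
    have "p a \<in> set (cyc p i)" using cyc_closed[OF permutation_unspliced that] .
    then have "p a \<noteq> x" using sub x by blast
    then show ?thesis by (simp add: splice_apply)
  qed
  then have me: "map (\<lambda>a. m a (q a)) (cyc p i)
      = map (\<lambda>a. if p a = i then m a x else m a (p a)) (cyc p i)"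
    by (intro map_cong[OF refl])
  show ?thesis unfolding cycle_weight_def cyc_splice map_append prod_list.append me
    using sx by simp
qed

lemma cycle_weight_splice_other:
  assumes a: "a \<in> T" "a \<notin> set (cyc p i)"
  shows "cycle_weight m q a = cycle_weight (\<lambda>a b. if b = i then m a x else m a b) p a"
proof -
  have sub: "set (cyc p a) \<subseteq> insert i T" by (rule set_cyc_subset[OF p]) (use a in simp)
  have "set (cyc p a) \<inter> set (cyc p i) = {}" using disjoint_cyc[OF permutation_unspliced] a(2) by simp
  then have ni: "i \<notin> set (cyc p a)" using in_cyc[OF permutation_unspliced, of i] by blast
  have "m b (q b) = (if p b = i then m b x else m b (p b))" if "b \<in> set (cyc p a)" for b
  proof -
    have "p b \<in> set (cyc p a)" using cyc_closed[OF permutation_unspliced that] .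
    then have "p b \<noteq> i" "p b \<noteq> x" using ni sub x by auto
    then show ?thesis by (simp add: splice_apply)
  qed
  then show ?thesis unfolding cycle_weight_def cyc_splice_other[OF a]
    by (intro arg_cong[of _ _ prod_list] map_cong[OF refl])
qed

end

text \<open>The permutations of \<open>insert i S\<close> are sorted by the preimage of \<open>i\<close>: either \<open>i\<close> is fixed, or its
preimage is some \<open>x \<in> S\<close>, and then \<open>x\<close> can be removed from its cycle.\<close>

lemma sum_permutes_preimage:
  fixes f :: "(nat \<Rightarrow> nat) \<Rightarrow> 'b :: comm_monoid_add"
  assumes S: "finite S" "i \<notin> S"
  shows "(\<Sum>p | p permutes insert i S. f p) =
    (\<Sum>p | p permutes S. f p) + (\<Sum>x\<in>S. \<Sum>p | p permutes insert i (S - {x}). f (transpose x i \<circ> p))"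
proof -
  let ?P = "{p. p permutes insert i S}"
  have sub: "(\<lambda>p. inv_into UNIV p i) ` ?P \<subseteq> insert i S"
  proof (rule image_subsetI)
    fix p assume "p \<in> ?P"
    then have "inv_into UNIV p permutes insert i S" by (simp add: permutes_inv)
    then show "inv_into UNIV p i \<in> insert i S" by (simp only: permutes_in_image insertI1)
  qed
  have "finite ?P" "finite (insert i S)" using S by (simp_all add: finite_permutations)
  from sum.group[OF this sub, of f]
  have "(\<Sum>p\<in>?P. f p) = (\<Sum>x\<in>insert i S. \<Sum>p | p \<in> ?P \<and> inv_into UNIV p i = x. f p)" by (rule sym)
  also have "\<dots> = (\<Sum>p | p \<in> ?P \<and> inv_into UNIV p i = i. f p) + (\<Sum>x\<in>S. \<Sum>p | p \<in> ?P \<and> inv_into UNIV p i = x. f p)"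
    using S by simp
  also have "{p. p \<in> ?P \<and> inv_into UNIV p i = i} = {p. p permutes S}"
  proof (intro equalityI subsetI)
    fix p assume "p \<in> {p. p \<in> ?P \<and> inv_into UNIV p i = i}"
    then have p: "p permutes insert i S" "inv_into UNIV p i = i" by auto
    then have "p i = i" by (metis permutes_inverses(1))
    then show "p \<in> {p. p permutes S}" using p(1) by (auto intro: permutes_superset)
  next
    fix p assume "p \<in> {p. p permutes S}"
    then have p: "p permutes S" by simp
    then have "p i = i" using S(2) by (simp add: permutes_def)
    then have "inv_into UNIV p i = i" using p by (metis permutes_inverses(2))
    moreover have "p permutes insert i S" using p by (rule permutes_subset) auto
    ultimately show "p \<in> {p. p \<in> ?P \<and> inv_into UNIV p i = i}" by simp
  qed
  also have "(\<Sum>x\<in>S. \<Sum>p | p \<in> ?P \<and> inv_into UNIV p i = x. f p)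
      = (\<Sum>x\<in>S. \<Sum>p | p permutes insert i (S - {x}). f (transpose x i \<circ> p))"
  proof (rule sum.cong[OF refl])
    fix x assume x: "x \<in> S"
    then have xi: "x \<noteq> i" using S(2) by auto
    have ins: "insert x (insert i (S - {x})) = insert i S" using x by auto
    show "(\<Sum>p | p \<in> ?P \<and> inv_into UNIV p i = x. f p)
        = (\<Sum>p | p permutes insert i (S - {x}). f (transpose x i \<circ> p))"
    proof (rule sum.reindex_bij_witness[where i = "\<lambda>p. transpose x i \<circ> p" and j = "\<lambda>p. transpose x i \<circ> p"])
      fix p assume "p \<in> {p. p \<in> ?P \<and> inv_into UNIV p i = x}"
      then have p: "p permutes insert i S" "inv_into UNIV p i = x" by auto
      show "transpose x i \<circ> (transpose x i \<circ> p) = p" by (simp add: fun_eq_iff)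
      have px: "p x = i" using p by (metis permutes_inverses(1))
      have "transpose x i \<circ> p permutes insert i S"
        using p(1) by (rule permutes_compose) (rule permutes_swap_id; use x in simp)
      then show "transpose x i \<circ> p \<in> {p. p permutes insert i (S - {x})}"
        using px by (auto intro: permutes_superset)
      show "f (transpose x i \<circ> (transpose x i \<circ> p)) = f p" by (simp add: comp_def)
    next
      fix p assume "p \<in> {p. p permutes insert i (S - {x})}"
      then have p: "p permutes insert i (S - {x})" by simp
      show "transpose x i \<circ> (transpose x i \<circ> p) = p" by (simp add: fun_eq_iff)
      have px: "p x = x" using p xi by (auto simp: permutes_def)
      have P: "transpose x i \<circ> p permutes insert i S"
        using splice_permutes[OF _ p _ refl, of x] S(1) xi ins by auto
      moreover have "(transpose x i \<circ> p) x = i" using px by simp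
      ultimately have "inv_into UNIV (transpose x i \<circ> p) i = x" by (metis permutes_inverses(2))
      with P show "transpose x i \<circ> p \<in> {p. p \<in> ?P \<and> inv_into UNIV p i = x}" by simp
    qed
  qed
  finally show ?thesis .
qed

text \<open>Cofactor expansion along column \<open>i\<close>.  The entry of column \<open>i\<close> is the last factor of every
monomial, so it splits off on the right.  The cofactor of \<open>m x i\<close> is again a column determinant,
with column \<open>x\<close> put in the place of column \<open>i\<close>; the sign changes because a point has disappeared
while the number of cycles has not.\<close>

lemma perm_cdet_rec:
  assumes S: "finite S" "i \<notin> S"
  shows "perm_cdet m (insert i S) i = perm_det m S * m i i -
    (\<Sum>x\<in>S. perm_cdet (\<lambda>a b. if b = i then m a x else m a b) (insert i (S - {x})) i * m x i)"
proof -
  let ?t = "\<lambda>m S p. (-1) ^ (card S - ncycles S p) *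
     prod_list (map (cycle_weight m p) (rev (sorted_list_of_set (leaders S p - set (cyc p i))) @ [i]))"
  let ?m = "\<lambda>x a b. if b = i then m a x else m a b"
  have 1: "?t m (insert i S) p = (-1) ^ (card S - ncycles S p) *
     prod_list (map (cycle_weight m p) (rev (sorted_list_of_set (leaders S p)))) * m i i"
    if "p permutes S" for p
  proof -
    have pi: "p i = i" using that S(2) by (simp add: permutes_def)
    have sup: "cyc p i = [i]" by (rule cyc_eqI) (auto simp: pi)
    have si: "i \<notin> set (cyc p a)" if "a \<in> S" for a
      using set_cyc_subset[OF \<open>p permutes S\<close> that] S(2) by blast
    have "leaders (insert i S) p - {i} = leaders S p" unfolding leaders_def using S(2) by auto
    moreover have "ncycles (insert i S) p = Suc (ncycles S p)"
    proof -
      have "{i} \<notin> (\<lambda>a. set (cyc p a)) ` S" using si by blast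
      moreover have "(\<lambda>a. set (cyc p a)) ` insert i S = insert {i} ((\<lambda>a. set (cyc p a)) ` S)"
        unfolding image_insert sup by simp
      ultimately show ?thesis unfolding ncycles_def using S(1) by (metis card_insert_disjoint finite_imageI)
    qed
    moreover have "cycle_weight m p i = m i i" unfolding cycle_weight_def sup by (simp add: pi)
    ultimately show ?thesis unfolding sup using S by (simp add: mult.assoc)
  qed
  have 2: "?t m (insert i S) (transpose x i \<circ> p) = - (?t (?m x) (insert i (S - {x})) p * m x i)"
    if x: "x \<in> S" and p: "p permutes insert i (S - {x})" for x p
  proof -
    have c: "finite (S - {x})" "x \<notin> insert i (S - {x})" using S x by auto
    have ins: "insert x (insert i (S - {x})) = insert i S" using x by auto
    note a = c(1) p c(2) refl
    let ?L = "leaders (insert i (S - {x})) p - set (cyc p i)"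
    have L: "leaders (insert i S) (transpose x i \<circ> p) - set (cyc (transpose x i \<circ> p) i) = ?L"
      using leaders_splice[OF a] unfolding ins .
    have N: "ncycles (insert i S) (transpose x i \<circ> p) = ncycles (insert i (S - {x})) p"
      using ncycles_splice[OF a] unfolding ins .
    have fL: "finite ?L" unfolding leaders_def using S by auto
    have "i \<in> set (cyc p i)" using in_cyc[OF permutation_unspliced[OF a]] .
    then have LS: "?L \<subseteq> S - {x}" unfolding leaders_def by auto
    have me: "map (cycle_weight m (transpose x i \<circ> p)) (rev (sorted_list_of_set ?L))
        = map (cycle_weight (?m x) p) (rev (sorted_list_of_set ?L))"
      using cycle_weight_splice_other[OF a] LS fL by (intro map_cong[OF refl]) auto
    have sgn: "(-1 :: 'a) ^ (card (insert i S) - ncycles (insert i (S - {x})) p) =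
        - ((-1) ^ (card (insert i (S - {x})) - ncycles (insert i (S - {x})) p))"
    proof -
      have "card (insert i S) = Suc (card (insert i (S - {x})))"
        using S x c by (metis card_insert_disjoint finite_insert ins)
      moreover have "ncycles (insert i (S - {x})) p \<le> card (insert i (S - {x}))"
        using c by (intro ncycles_le) simp
      ultimately show ?thesis by (simp add: Suc_diff_le)
    qed
    show ?thesis unfolding L N map_append prod_list.append list.map me sgn cycle_weight_splice[OF a]
      by (simp add: mult.assoc)
  qed
  show ?thesis unfolding perm_cdet_def sum_permutes_preimage[OF S] 
    using 1 2 by (simp add: perm_det_def sum_distrib_right sum_negf)
qed

text \<open>The smallest element of \<open>S\<close> is the first leader, so its cycle comes last in the reversed list.\<close>

lemma perm_det_eq_perm_cdet:
  assumes S: "finite S" "S \<noteq> {}"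
  shows "perm_det m S = perm_cdet m S (Min S)"
proof -
  let ?a = "Min S"
  have "sorted_list_of_set (leaders S p) = ?a # sorted_list_of_set (leaders S p - set (cyc p ?a))"
    if p: "p permutes S" for p
  proof -
    have P: "permutation p" using p S(1) by (intro permutes_imp_permutation)
    have a: "?a \<in> S" using S by simp
    have ma: "Min (set (cyc p b)) = ?a" if "b \<in> set (cyc p ?a)" for b
      unfolding set_cyc_eq[OF P that]
      using set_cyc_subset[OF p a] in_cyc[OF P, of ?a] S
      by (intro Min_eqI) auto
    then have "leaders S p \<inter> set (cyc p ?a) \<subseteq> {?a}" unfolding leaders_def by auto
    moreover have "?a \<in> leaders S p"
      unfolding leaders_def using a ma[OF in_cyc[OF P]] by simp
    moreover note in_cyc[OF P, of ?a]
    ultimately have "leaders S p = insert ?a (leaders S p - set (cyc p ?a))" by auto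
    moreover have fin: "finite (leaders S p - set (cyc p ?a))" "leaders S p - set (cyc p ?a) \<subseteq> S" unfolding leaders_def using S by auto
    moreover have "?a \<notin> leaders S p - set (cyc p ?a)" using in_cyc[OF P, of ?a] by blast
    moreover have "x \<in> leaders S p - set (cyc p ?a) \<Longrightarrow> ?a \<le> x" for x using fin(2) S by auto
    ultimately show ?thesis
      by (metis (no_types, lifting) insort_is_Cons sorted_list_of_set.sorted_key_list_of_set_insert set_sorted_list_of_set)
  qed
  then show ?thesis unfolding perm_det_def perm_cdet_def by (intro sum.cong[OF refl]) simp
qed

lemma perm_det_empty: "perm_det m {} = 1"
  unfolding perm_det_def by (simp add: leaders_def ncycles_def)

section \<open>Inverse permutations and conjugate transposes\<close>

lemma cyc_inverse:
  assumes p: "p permutes S" "finite S"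
  shows "cyc (inv_into UNIV p) a = rev (map p (cyc p a))"
proof (rule cyc_eqI)
  let ?xs = "cyc p a"
  have P: "permutation p" using p by (intro permutes_imp_permutation)
  have inj: "inj p" using p(1) by (rule permutes_inj)
  show "distinct (rev (map p ?xs))"
    using distinct_cyc[OF P] inj_on_subset[OF inj subset_UNIV] by (simp add: distinct_map)
  show "rev (map p ?xs) \<noteq> []" using cyc_ne[OF P] by simp
  show "hd (rev (map p ?xs)) = a"
    using cyc_ne[OF P] last_cyc[OF P] by (simp add: hd_rev last_map)
  show "inv_into UNIV p (last (rev (map p ?xs))) = a"
    using cyc_ne[OF P] hd_cyc[OF P] inj by (simp add: last_rev hd_map)
  fix k assume "Suc k < length (rev (map p ?xs))"
  then have k: "Suc k < length ?xs" by simp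
  have "p (p (?xs ! (length ?xs - Suc (Suc k)))) = p (?xs ! Suc (length ?xs - Suc (Suc k)))"
    by (subst cyc_nth_Suc) (use k in auto)
  also have "Suc (length ?xs - Suc (Suc k)) = length ?xs - Suc k" using k by simp
  finally have "inv_into UNIV p (p (?xs ! (length ?xs - Suc k))) = p (?xs ! (length ?xs - Suc (Suc k)))"
    using inj by (metis inv_f_f)
  then show "inv_into UNIV p (rev (map p ?xs) ! k) = rev (map p ?xs) ! Suc k"
    using k by (simp add: rev_nth)
qed

lemma set_cyc_inverse:
  assumes p: "p permutes S" "finite S"
  shows "set (cyc (inv_into UNIV p) a) = set (cyc p a)"
proof -
  have P: "permutation p" using p by (intro permutes_imp_permutation)
  have "p ` set (cyc p a) \<subseteq> set (cyc p a)" using cyc_closed[OF P] by blast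
  then have "p ` set (cyc p a) = set (cyc p a)"
    using permutes_inj[OF p(1)] by (intro endo_inj_surj) (auto intro: inj_on_subset)
  then show ?thesis unfolding cyc_inverse[OF p] by simp
qed

lemma quat_eq_iff: "p = q \<longleftrightarrow> qre p = qre q \<and> qi p = qi q \<and> qj p = qj q \<and> qk p = qk q"
  by (cases p; cases q) simp

lemma quat_sel [simp]:
  "qre 0 = 0" "qi 0 = 0" "qj 0 = 0" "qk 0 = 0"
  "qre 1 = 1" "qi 1 = 0" "qj 1 = 0" "qk 1 = 0"
  "qre (p + q) = qre p + qre q" "qi (p + q) = qi p + qi q"
  "qj (p + q) = qj p + qj q" "qk (p + q) = qk p + qk q"
  "qre (p - q) = qre p - qre q" "qi (p - q) = qi p - qi q"
  "qj (p - q) = qj p - qj q" "qk (p - q) = qk p - qk q"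
  "qre (- p) = - qre p" "qi (- p) = - qi p" "qj (- p) = - qj p" "qk (- p) = - qk p"
  "qre (conjugate p) = qre p" "qi (conjugate p) = - qi p"
  "qj (conjugate p) = - qj p" "qk (conjugate p) = - qk p"
  by (simp_all add: zero_quat_def one_quat_def plus_quat_def minus_quat_def uminus_quat_def
      conjugate_quat_def)

lemma quat_times_sel:
  "qre (p * q) = qre p * qre q - qi p * qi q - qj p * qj q - qk p * qk q"
  "qi (p * q) = qre p * qi q + qi p * qre q + qj p * qk q - qk p * qj q"
  "qj (p * q) = qre p * qj q - qi p * qk q + qj p * qre q + qk p * qi q"
  "qk (p * q) = qre p * qk q + qi p * qj q - qj p * qi q + qk p * qre q"
  by (simp_all add: times_quat_def)

lemma qcnj_add: "conjugate (p + q) = conjugate p + conjugate (q :: quat)"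
  and qcnj_diff: "conjugate (p - q) = conjugate p - conjugate (q :: quat)"
  and qcnj_minus: "conjugate (- p) = - conjugate (p :: quat)"
  and qcnj_zero: "conjugate (0 :: quat) = 0"
  and qcnj_one: "conjugate (1 :: quat) = 1"
  by (simp_all add: quat_eq_iff)

lemma qcnj_mult: "conjugate (p * q) = conjugate q * conjugate (p :: quat)"
  by (simp add: quat_eq_iff quat_times_sel)

lemma qcnj_sum: "conjugate (sum f A) = (\<Sum>x\<in>A. conjugate (f x :: quat))"
  by (induction A rule: infinite_finite_induct) (simp_all add: qcnj_zero qcnj_add)

lemma qcnj_prod_list: "conjugate (prod_list xs) = prod_list (rev (map conjugate (xs :: quat list)))"
  by (induction xs) (simp_all add: qcnj_one qcnj_mult)

lemma qcnj_sign: "conjugate ((-1) ^ n :: quat) = (-1) ^ n"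
  by (induction n) (simp_all add: qcnj_one qcnj_minus)

lemma qre_sum: "qre (sum f A) = (\<Sum>x\<in>A. qre (f x))"
  by (induction A rule: infinite_finite_induct) simp_all

lemma qre_of_nat [simp]: "qre (of_nat k) = real k"
  by (induction k) simp_all

lemma qre_mult_commute: "qre (p * q) = qre (q * p)"
  by (simp add: quat_times_sel)

lemma real_quat_iff: "conjugate q = q \<longleftrightarrow> qi q = 0 \<and> qj q = 0 \<and> qk q = 0"
  by (auto simp: quat_eq_iff)

lemma real_quat_commute: "conjugate q = q \<Longrightarrow> q * p = p * (q :: quat)"
  unfolding real_quat_iff by (simp add: quat_eq_iff quat_times_sel)

lemma real_quat_eqI: "conjugate p = p \<Longrightarrow> conjugate q = q \<Longrightarrow> qre p = qre q \<Longrightarrow> p = q"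
  unfolding real_quat_iff by (simp add: quat_eq_iff)

text \<open>Conjugation reverses products.  It reverses the order in which the cycles are listed and the
direction in which each cycle is run through, that is, it turns a permutation into its inverse.\<close>

lemma rdet_conj_transpose:
  fixes M :: "quat mat"
  assumes M: "M \<in> carrier_mat n n" and i: "i < n"
  shows "rdet i (conj_transpose M) = conjugate (cdet i M)"
proof -
  let ?N = "conj_transpose M" and ?inv = "\<lambda>p. inv_into UNIV p"
  let ?S = "{p. p permutes {0..<n}}"
  let ?w = "\<lambda>p. sorted_list_of_set (leaders {0..<n} p - set (cyc p i))"
  have dim: "dim_row ?N = n" "dim_row M = n" using M by (auto simp: conj_transpose_def)
  have N: "?N $$ (x, y) = conjugate (M $$ (y, x))" if "x < n" "y < n" for x y
    using M that by (simp add: conj_transpose_def)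
  have cl: "cycle_leaders n p i = leaders {0..<n} p - set (cyc p i)" for p
    unfolding cycle_leaders_def leaders_def cyc_def by auto
  have "rdet i ?N = (\<Sum>p\<in>?S. (-1) ^ (n - ncycles {0..<n} p) *
      prod_list (map (cycle_prod ?N p) (i # ?w p)))"
    unfolding rdet_def dim Let_def cl num_cycles_def ncycles_def cyc_def[symmetric] ..
  also have "\<dots> = (\<Sum>p\<in>?S. (-1) ^ (n - ncycles {0..<n} (?inv p)) *
      prod_list (map (cycle_prod ?N (?inv p)) (i # ?w (?inv p))))"
    by (rule sum.reindex_bij_witness[where i = ?inv and j = ?inv])
      (auto simp: permutes_inv permutes_inv_inv)
  also have "\<dots> = (\<Sum>p\<in>?S. conjugate ((-1) ^ (n - ncycles {0..<n} p) *
      prod_list (map (cycle_weight (\<lambda>x y. M $$ (x, y)) p) (rev (?w p) @ [i]))))"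
  proof (rule sum.cong[OF refl])
    fix p assume "p \<in> ?S"
    then have p: "p permutes {0..<n}" by simp
    have sc: "set (cyc (?inv p) a) = set (cyc p a)" for a
      using set_cyc_inverse[OF p] by simp
    have nc: "ncycles {0..<n} (?inv p) = ncycles {0..<n} p" unfolding ncycles_def sc ..
    have w: "?w (?inv p) = ?w p" unfolding leaders_def sc ..
    have cp: "cycle_prod ?N (?inv p) a = conjugate (cycle_weight (\<lambda>x y. M $$ (x, y)) p a)" if a: "a < n" for a
    proof -
      have sub: "set (cyc p a) \<subseteq> {0..<n}" using set_cyc_subset[OF p] a by simp
      have "cycle_prod ?N (?inv p) a = prod_list (map (\<lambda>x. ?N $$ (x, ?inv p x)) (cyc (?inv p) a))"
        unfolding cycle_prod_def cyc_def ..
      also have "\<dots> = prod_list (map (\<lambda>x. ?N $$ (p x, x)) (rev (cyc p a)))"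
        unfolding cyc_inverse[OF p finite_atLeastLessThan] using permutes_inj[OF p]
        by (simp add: rev_map comp_def)
      also have "map (\<lambda>x. ?N $$ (p x, x)) (rev (cyc p a)) = map (\<lambda>x. conjugate (M $$ (x, p x))) (rev (cyc p a))"
        using sub permutes_in_image[OF p] by (intro map_cong[OF refl] N) auto
      also have "prod_list \<dots> = conjugate (cycle_weight (\<lambda>x y. M $$ (x, y)) p a)"
        unfolding cycle_weight_def qcnj_prod_list by (simp add: rev_map comp_def)
      finally show ?thesis .
    qed
    have "set (?w p) \<subseteq> {0..<n}"
      by (subst set_sorted_list_of_set) (auto simp: leaders_def)
    then have me: "map (cycle_prod ?N (?inv p)) (i # ?w p) = map (\<lambda>a. conjugate (cycle_weight (\<lambda>x y. M $$ (x, y)) p a)) (i # ?w p)"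
      using i by (intro map_cong[OF refl] cp) auto
    show "(-1) ^ (n - ncycles {0..<n} (?inv p)) *
        prod_list (map (cycle_prod ?N (?inv p)) (i # ?w (?inv p))) =
      conjugate ((-1) ^ (n - ncycles {0..<n} p) *
        prod_list (map (cycle_weight (\<lambda>x y. M $$ (x, y)) p) (rev (?w p) @ [i])))"
      unfolding nc w me qcnj_mult qcnj_sign qcnj_prod_list
      by (simp add: rev_map comp_def real_quat_commute[OF qcnj_sign])
  qed
  also have "\<dots> = conjugate (cdet i M)"
    unfolding cdet_eq_perm_cdet perm_cdet_def dim qcnj_sum by simp
  finally show ?thesis .
qed

section \<open>Recursive form of the column determinant\<close>

text \<open>\<open>cdet_on m S i v\<close> is meant for \<open>i \<notin> S\<close>: it is the column determinant along \<open>i\<close> of the submatrix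
on \<open>insert i S\<close> whose column \<open>i\<close> has been replaced by \<open>v\<close>, defined by its cofactor expansion.  Only the
rows \<open>insert i S\<close> and the columns \<open>S\<close> of \<open>m\<close> enter, so the matrix need not be modified when a
column is replaced, and renumbering the indices is a simple induction.\<close>

function cdet_on :: "(nat \<Rightarrow> nat \<Rightarrow> 'a :: ring_1) \<Rightarrow> nat set \<Rightarrow> nat \<Rightarrow> (nat \<Rightarrow> 'a) \<Rightarrow> 'a" where
  "cdet_on m S i v = (if infinite S then 0 else
     (if S = {} then 1 else cdet_on m (S - {Min S}) (Min S) (\<lambda>x. m x (Min S))) * v i -
     (\<Sum>x\<in>S. cdet_on m (S - {x}) i (\<lambda>a. m a x) * v x))"
  by auto
termination
proof (relation "measure (\<lambda>(m, S, i, v). card S)", goal_cases)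
  case (2 m S i v)
  then have "card (S - {Min S}) < card S" by (intro card_Diff1_less) auto
  then show ?case by simp
next
  case (3 m S i v x)
  then have "card (S - {x}) < card S" by (intro card_Diff1_less) auto
  then show ?case by simp
qed simp

declare cdet_on.simps [simp del]

definition det_on :: "(nat \<Rightarrow> nat \<Rightarrow> 'a :: ring_1) \<Rightarrow> nat set \<Rightarrow> 'a" where
  "det_on m S = (if S = {} then 1 else cdet_on m (S - {Min S}) (Min S) (\<lambda>x. m x (Min S)))"

lemma cdet_on_rec:
  "finite S \<Longrightarrow> cdet_on m S i v =
     det_on m S * v i - (\<Sum>x\<in>S. cdet_on m (S - {x}) i (\<lambda>a. m a x) * v x)"
  by (subst cdet_on.simps) (simp add: det_on_def)

text \<open>Only the order of the elements of \<open>S\<close> matters, through \<open>Min\<close>; this makes the renumbering of rows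
and columns by \<open>submatrix\<close> harmless.\<close>

lemma cdet_on_reindex:
  assumes "finite S" "strict_mono_on S f"
    "\<And>x y. x \<in> insert i S \<Longrightarrow> y \<in> S \<Longrightarrow> m' (f x) (f y) = m x y"
    "\<And>x. x \<in> insert i S \<Longrightarrow> v' (f x) = v x"
  shows "cdet_on m' (f ` S) (f i) v' = cdet_on m S i v"
  using assms
proof (induction S arbitrary: i v v' rule: finite_psubset_induct)
  case (psubset S)
  have inj: "inj_on f S" using psubset.prems(1) by (rule strict_mono_on_imp_inj_on)
  have rem: "f ` S - {f x} = f ` (S - {x})" if "x \<in> S" for x
    using inj that by (auto simp: inj_on_def)
  have mono: "strict_mono_on (S - {x}) f" for x
    using psubset.prems(1) by (auto simp: strict_mono_on_def)
  have "det_on m' (f ` S) = det_on m S"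
  proof (cases "S = {}")
    case False
    have mS: "Min S \<in> S" using False psubset.hyps by simp
    have mf: "Min (f ` S) = f (Min S)"
    proof (rule Min_eqI)
      fix y assume "y \<in> f ` S"
      then obtain z where z: "z \<in> S" "y = f z" by blast
      have "Min S \<le> z" using z(1) psubset.hyps(1) by (rule Min_le[rotated])
      then show "f (Min S) \<le> y"
        unfolding z(2) using strict_mono_on_leD[OF psubset.prems(1) mS z(1)] by simp
    next
      show "finite (f ` S)" using psubset.hyps(1) by (rule finite_imageI)
      show "f (Min S) \<in> f ` S" using mS by (rule imageI)
    qed
    have "cdet_on m' (f ` (S - {Min S})) (f (Min S)) (\<lambda>x. m' x (f (Min S)))
        = cdet_on m (S - {Min S}) (Min S) (\<lambda>x. m x (Min S))"
      using mS by (intro psubset.IH mono psubset.prems(2)) auto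
    then show ?thesis using False mS unfolding det_on_def mf by (simp add: rem)
  qed (simp add: det_on_def)
  moreover have "(\<Sum>x\<in>f ` S. cdet_on m' (f ` S - {x}) (f i) (\<lambda>a. m' a x) * v' x)
      = (\<Sum>x\<in>S. cdet_on m (S - {x}) i (\<lambda>a. m a x) * v x)"
    unfolding sum.reindex[OF inj] comp_def
  proof (rule sum.cong[OF refl])
    fix x assume x: "x \<in> S"
    have "cdet_on m' (f ` (S - {x})) (f i) (\<lambda>a. m' a (f x)) = cdet_on m (S - {x}) i (\<lambda>a. m a x)"
      using x by (intro psubset.IH mono psubset.prems(2)) auto
    then show "cdet_on m' (f ` S - {f x}) (f i) (\<lambda>a. m' a (f x)) * v' (f x)
        = cdet_on m (S - {x}) i (\<lambda>a. m a x) * v x"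
      unfolding rem[OF x] using psubset.prems(3)[of x] x by simp
  qed
  moreover have "v' (f i) = v i" by (rule psubset.prems(3)) simp
  ultimately show ?case
    unfolding cdet_on_rec[OF psubset.hyps(1)] cdet_on_rec[OF finite_imageI[OF psubset.hyps(1)]]
    by (simp only:)
qed

lemma cdet_on_cong:
  assumes "finite S" "\<And>x y. x \<in> insert i S \<Longrightarrow> y \<in> S \<Longrightarrow> m' x y = m x y"
    "\<And>x. x \<in> insert i S \<Longrightarrow> v' x = v x"
  shows "cdet_on m' S i v' = cdet_on m S i v"
  using cdet_on_reindex[of S id i m' m v' v] assms by (simp add: strict_mono_on_def)

lemma perm_cdet_eq_cdet_on:
  assumes "finite S" "i \<notin> S"
  shows "perm_cdet m (insert i S) i = cdet_on m S i (\<lambda>x. m x i)"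
  using assms
proof (induction S arbitrary: i m rule: finite_psubset_induct)
  case (psubset S)
  have "perm_det m S = det_on m S"
  proof (cases "S = {}")
    case False
    then have mS: "Min S \<in> S" using psubset.hyps by simp
    have "perm_cdet m (insert (Min S) (S - {Min S})) (Min S) = cdet_on m (S - {Min S}) (Min S) (\<lambda>x. m x (Min S))"
      using mS by (intro psubset.IH) auto
    then show ?thesis using False mS psubset.hyps
      by (simp add: perm_det_eq_perm_cdet det_on_def insert_absorb)
  qed (simp add: perm_det_empty det_on_def)
  moreover have "perm_cdet (\<lambda>a b. if b = i then m a x else m a b) (insert i (S - {x})) i
      = cdet_on m (S - {x}) i (\<lambda>a. m a x)" if "x \<in> S" for x
  proof -
    have "perm_cdet (\<lambda>a b. if b = i then m a x else m a b) (insert i (S - {x})) i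
      = cdet_on (\<lambda>a b. if b = i then m a x else m a b) (S - {x}) i (\<lambda>a. if i = i then m a x else m a i)"
      using that psubset.prems by (intro psubset.IH) auto
    also have "\<dots> = cdet_on m (S - {x}) i (\<lambda>a. m a x)"
      using psubset.hyps psubset.prems by (intro cdet_on_cong) auto
    finally show ?thesis .
  qed
  ultimately show ?case
    unfolding perm_cdet_rec[OF psubset.hyps psubset.prems] cdet_on_rec[OF psubset.hyps] by simp
qed

lemma cdet_eq_cdet_on:
  assumes "dim_row M = n" "i < n"
  shows "cdet i M = cdet_on (\<lambda>x y. M $$ (x, y)) ({0..<n} - {i}) i (\<lambda>x. M $$ (x, i))"
proof -
  have "insert i ({0..<n} - {i}) = {0..<n}" using assms by auto
  then show ?thesis
    using perm_cdet_eq_cdet_on[of "{0..<n} - {i}" i "\<lambda>x y. M $$ (x, y)"]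
    by (simp add: cdet_eq_perm_cdet assms)
qed

lemma
  assumes b: "b \<subseteq> {0..<n}"
  shows pick_strict_mono_on: "strict_mono_on {0..<card b} (pick b)"
    and pick_image: "pick b ` {0..<card b} = b"
proof -
  show m: "strict_mono_on {0..<card b} (pick b)"
    using pick_mono_le by (auto simp: strict_mono_on_def)
  have fin: "finite b" using b finite_subset by blast
  show "pick b ` {0..<card b} = b"
  proof (rule card_subset_eq[OF fin])
    show "pick b ` {0..<card b} \<subseteq> b" using pick_in_set_le by auto
    show "card (pick b ` {0..<card b}) = card b"
      using strict_mono_on_imp_inj_on[OF m] by (simp add: card_image)
  qed
qed

lemma principal_submatrix_carrier:
  assumes M: "M \<in> carrier_mat n n" and b: "b \<subseteq> {0..<n}"
  shows "principal_submatrix M b \<in> carrier_mat (card b) (card b)"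
    and "x < card b \<Longrightarrow> y < card b \<Longrightarrow> principal_submatrix M b $$ (x, y) = M $$ (pick b x, pick b y)"
proof -
  have e: "{i. i < n \<and> i \<in> b} = b" using b by auto
  have d: "dim_row M = n" "dim_col M = n" using M by auto
  show "principal_submatrix M b \<in> carrier_mat (card b) (card b)"
    by (rule carrier_matI) (simp_all only: dim_submatrix d e)
  show "principal_submatrix M b $$ (x, y) = M $$ (pick b x, pick b y)" if "x < card b" "y < card b"
    by (rule submatrix_index) (simp_all only: d e that)
qed

lemma cdet_principal_submatrix:
  assumes M: "M \<in> carrier_mat n n" and b: "b \<subseteq> {0..<n}" and c: "c < card b"
  shows "cdet c (principal_submatrix M b)
    = cdet_on (\<lambda>x y. M $$ (x, y)) (b - {pick b c}) (pick b c) (\<lambda>x. M $$ (x, pick b c))"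
proof -
  let ?N = "principal_submatrix M b"
  note N = principal_submatrix_carrier[OF M b]
  note mono = pick_strict_mono_on[OF b]
  have "cdet c ?N = cdet_on (\<lambda>x y. ?N $$ (x, y)) ({0..<card b} - {c}) c (\<lambda>x. ?N $$ (x, c))"
    using N(1) c by (intro cdet_eq_cdet_on) auto
  also have "\<dots> = cdet_on (\<lambda>x y. M $$ (x, y)) (pick b ` ({0..<card b} - {c})) (pick b c)
      (\<lambda>x. M $$ (x, pick b c))"
    using mono c by (intro cdet_on_reindex[symmetric]) (auto simp: N(2) strict_mono_on_def)
  also have "pick b ` ({0..<card b} - {c}) = pick b ` {0..<card b} - {pick b c}"
    using strict_mono_on_imp_inj_on[OF mono] c by (subst inj_on_image_set_diff[of _ "{0..<card b}"]) auto
  finally show ?thesis unfolding pick_image[OF b] .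
qed

lemma cdet_principal_eq_cdet_on:
  assumes M: "M \<in> carrier_mat n n" and b: "b \<subseteq> {0..<n}" and i: "i \<in> b"
  shows "cdet_principal i M b
    = cdet_on (\<lambda>x y. M $$ (x, y)) (b - {i}) i (\<lambda>x. M $$ (x, i))"
proof -
  have "finite b" using b finite_subset by blast
  then have "card {a \<in> b. a < i} < card b" using i by (intro psubset_card_mono) auto
  from cdet_principal_submatrix[OF M b this] show ?thesis
    unfolding cdet_principal_def pick_card_in_set[OF i] .
qed

section \<open>Signed sums over paths\<close>

text \<open>The signed sum, over all paths \<open>i, y\<^sub>1, \<dots>, y\<^sub>l\<close> with distinct \<open>y\<^sub>1, \<dots>, y\<^sub>l \<in> S\<close>, of the products of
entries along the path times \<open>F R x\<close>, where \<open>R\<close> is the set of unvisited vertices and \<open>x\<close> is the last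
vertex of the path (\<open>i\<close> itself if \<open>l = 0\<close>).  The sign is
\<open>(-1)\<^sup>l\<close>.  The free choice of \<open>F\<close> is what allows paths to be cut and rearranged by plain induction.\<close>

function path_sum :: "(nat \<Rightarrow> nat \<Rightarrow> 'a :: ring_1) \<Rightarrow> (nat set \<Rightarrow> nat \<Rightarrow> 'a) \<Rightarrow> nat set \<Rightarrow> nat \<Rightarrow> 'a" where
  "path_sum m F S i = (if infinite S then 0 else
     F S i - (\<Sum>y\<in>S. m i y * path_sum m F (S - {y}) y))"
  by auto
termination
proof (relation "measure (\<lambda>(m, F, S, i). card S)", goal_cases)
  case (2 m F S i x)
  then have "card (S - {x}) < card S" by (intro card_Diff1_less) auto
  then show ?case by simp
qed simp

declare path_sum.simps [simp del]

lemma path_sum_rec: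
  "finite S \<Longrightarrow> path_sum m F S i = F S i - (\<Sum>y\<in>S. m i y * path_sum m F (S - {y}) y)"
  by (subst path_sum.simps) simp

lemma path_sum_cong:
  assumes "finite S" "\<And>R x. R \<subseteq> S \<Longrightarrow> F R x = G R x"
  shows "path_sum m F S i = path_sum m G S i"
  using assms
proof (induction S arbitrary: i rule: finite_psubset_induct)
  case (psubset S)
  have "path_sum m F (S - {y}) y = path_sum m G (S - {y}) y" if "y \<in> S" for y
    using that by (intro psubset.IH psubset.prems) auto
  then show ?case using psubset.prems[of S i] by (simp add: path_sum_rec[OF psubset.hyps(1)])
qed

lemma path_sum_diff:
  assumes "finite S"
  shows "path_sum m (\<lambda>R x. F R x - G R x) S i = path_sum m F S i - path_sum m G S i"
  using assms
proof (induction S arbitrary: i rule: finite_psubset_induct)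
  case (psubset S)
  have "path_sum m (\<lambda>R x. F R x - G R x) (S - {y}) y
      = path_sum m F (S - {y}) y - path_sum m G (S - {y}) y" if "y \<in> S" for y
    using that by (intro psubset.IH) auto
  then show ?case
    by (simp add: path_sum_rec[OF psubset.hyps(1)] right_diff_distrib sum_subtractf)
qed

lemma path_sum_mult_right:
  assumes "finite S"
  shows "path_sum m (\<lambda>R x. F R x * c) S i = path_sum m F S i * c"
  using assms
proof (induction S arbitrary: i rule: finite_psubset_induct)
  case (psubset S)
  have "path_sum m (\<lambda>R x. F R x * c) (S - {y}) y = path_sum m F (S - {y}) y * c" if "y \<in> S" for y
    using that by (intro psubset.IH) auto
  then show ?case
    by (simp add: path_sum_rec[OF psubset.hyps(1)] left_diff_distrib sum_distrib_right mult.assoc)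
qed

lemma path_sum_zero: "finite S \<Longrightarrow> path_sum m (\<lambda>R x. 0) S i = 0"
  using path_sum_mult_right[of S m "\<lambda>R x. 0" 0 i] by simp

text \<open>Cutting at \<open>j\<close>: a path either avoids \<open>j\<close>, which then stays unvisited, or it reaches \<open>j\<close> from some
vertex \<open>x\<close> and continues from there.\<close>

lemma path_sum_insert:
  assumes "finite U" "j \<notin> U"
  shows "path_sum m F (insert j U) i
    = path_sum m (\<lambda>R x. F (insert j R) x - m x j * path_sum m F R j) U i"
  using assms
proof (induction U arbitrary: i rule: finite_psubset_induct)
  case (psubset U)
  let ?G = "\<lambda>R x. F (insert j R) x - m x j * path_sum m F R j"
  have "path_sum m F (insert j U - {y}) y = path_sum m ?G (U - {y}) y" if "y \<in> U" for y
  proof -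
    have "insert j U - {y} = insert j (U - {y})" using that psubset.prems by auto
    then show ?thesis using that psubset.prems psubset.IH[of "U - {y}" y] by auto
  qed
  moreover have "insert j U - {j} = U" using psubset.prems by auto
  ultimately show ?case using psubset.hyps(1) psubset.prems
    by (simp add: path_sum_rec[of "insert j U"] path_sum_rec[OF psubset.hyps(1)])
qed

lemma sum_Diff_swap:
  assumes "finite S"
  shows "(\<Sum>x\<in>S. \<Sum>y\<in>S - {x}. f x y) = (\<Sum>y\<in>S. \<Sum>x\<in>S - {y}. f x y)"
proof -
  have e: "S - {x} = {y \<in> S. x \<noteq> y}" "S - {x} = {y \<in> S. y \<noteq> x}" for x by auto
  have "(\<Sum>x\<in>S. \<Sum>y\<in>S - {x}. f x y) = (\<Sum>x\<in>S. \<Sum>y | y \<in> S \<and> x \<noteq> y. f x y)"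
    by (simp only: e(1))
  also have "\<dots> = (\<Sum>y\<in>S. \<Sum>x | x \<in> S \<and> x \<noteq> y. f x y)"
    by (rule sum.swap_restrict[OF assms assms])
  also have "\<dots> = (\<Sum>y\<in>S. \<Sum>x\<in>S - {y}. f x y)" by (simp only: e(2))
  finally show ?thesis .
qed

text \<open>Singling out an unvisited vertex after the path has been chosen, or before.\<close>

lemma path_sum_sum:
  assumes "finite U"
  shows "path_sum m (\<lambda>R x. \<Sum>y\<in>R. F y (R - {y}) x) U j = (\<Sum>y\<in>U. path_sum m (F y) (U - {y}) j)"
  using assms
proof (induction U arbitrary: j rule: finite_psubset_induct)
  case (psubset U)
  let ?G = "\<lambda>R x. \<Sum>y\<in>R. F y (R - {y}) x"
  have dc: "U - {z} - {y} = U - {y} - {z}" for y z by auto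
  have "(\<Sum>z\<in>U. m j z * path_sum m ?G (U - {z}) z)
      = (\<Sum>z\<in>U. \<Sum>y\<in>U - {z}. m j z * path_sum m (F y) (U - {z} - {y}) z)"
  proof (rule sum.cong[OF refl])
    fix z assume "z \<in> U"
    then have "path_sum m ?G (U - {z}) z = (\<Sum>y\<in>U - {z}. path_sum m (F y) (U - {z} - {y}) z)"
      by (intro psubset.IH) auto
    then show "m j z * path_sum m ?G (U - {z}) z
        = (\<Sum>y\<in>U - {z}. m j z * path_sum m (F y) (U - {z} - {y}) z)"
      by (simp add: sum_distrib_left)
  qed
  also have "\<dots> = (\<Sum>y\<in>U. \<Sum>z\<in>U - {y}. m j z * path_sum m (F y) (U - {y} - {z}) z)"
    unfolding sum_Diff_swap[OF psubset.hyps(1), of "\<lambda>z y. m j z * path_sum m (F y) (U - {z} - {y}) z"]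
    by (intro sum.cong refl) (simp only: dc)
  finally have "path_sum m ?G U j = (\<Sum>y\<in>U. F y (U - {y}) j)
      - (\<Sum>y\<in>U. \<Sum>z\<in>U - {y}. m j z * path_sum m (F y) (U - {y} - {z}) z)"
    by (simp add: path_sum_rec[OF psubset.hyps(1)])
  also have "\<dots> = (\<Sum>y\<in>U. path_sum m (F y) (U - {y}) j)"
  proof -
    have "path_sum m (F y) (U - {y}) j = F y (U - {y}) j
        - (\<Sum>z\<in>U - {y}. m j z * path_sum m (F y) (U - {y} - {z}) z)" for y
      using psubset.hyps(1) by (intro path_sum_rec) simp
    then show ?thesis by (simp only: sum_subtractf)
  qed
  finally show ?case .
qed

section \<open>Column determinants of Hermitian matrices\<close>

locale hermitian_entries =
  fixes m :: "nat \<Rightarrow> nat \<Rightarrow> quat"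
  assumes herm: "conjugate (m x y) = m y x"
begin

text \<open>As a path sum, this runs over the walks from \<open>i\<close> to \<open>l\<close> whose intermediate vertices are distinct elements
of \<open>S\<close>.\<close>

abbreviation "walk S i l \<equiv> cdet_on m S i (\<lambda>a. m a l)"

text \<open>The three claims depend on each other and are proved together by induction on \<open>S\<close>.  The minors
of smaller sets are real, so they can be moved to the front of each monomial; this turns the expansion
along the last step of a path into one along the first step.  The two expansions are exchanged by
conjugation, which reverses paths; hence closed walks, and with them the minors of size \<open>S\<close>, are
real.\<close>

lemma hermitian_cdet_on:
  assumes "finite S"
  shows "conjugate (det_on m S) = det_on m S"
    and "cdet_on m S i v = det_on m S * v i - (\<Sum>y\<in>S. m i y * cdet_on m (S - {y}) y v)"
    and "conjugate (walk S i l) = walk S l i"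
proof -
  have "conjugate (det_on m S) = det_on m S \<and>
    (\<forall>i v. cdet_on m S i v = det_on m S * v i - (\<Sum>y\<in>S. m i y * cdet_on m (S - {y}) y v)) \<and>
    (\<forall>i l. conjugate (walk S i l) = walk S l i)"
    using assms
  proof (induction S rule: finite_psubset_induct)
    case (psubset S)
    note fin = psubset.hyps
    have sub: "S - {x} \<subset> S" if "x \<in> S" for x using that by auto
    have dc: "S - {x} - {y} = S - {y} - {x}" for x y by auto
    have real: "conjugate (det_on m S) = det_on m S"
    proof (cases "S = {}")
      case False
      then have "Min S \<in> S" using fin by simp
      then have "conjugate (walk (S - {Min S}) (Min S) (Min S)) = walk (S - {Min S}) (Min S) (Min S)"
        using psubset.IH[OF sub] by blast
      then show ?thesis unfolding det_on_def if_not_P[OF False] .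
    qed (simp add: det_on_def qcnj_one)
    have rec: "cdet_on m S i v = det_on m S * v i - (\<Sum>y\<in>S. m i y * cdet_on m (S - {y}) y v)" for i v
    proof -
      have "(\<Sum>x\<in>S. walk (S - {x}) i x * v x)
          = (\<Sum>x\<in>S. m i x * (det_on m (S - {x}) * v x)
             - (\<Sum>y\<in>S - {x}. m i y * (walk (S - {x} - {y}) y x * v x)))"
      proof (rule sum.cong[OF refl])
        fix x assume x: "x \<in> S"
        have "walk (S - {x}) i x = det_on m (S - {x}) * m i x - (\<Sum>y\<in>S - {x}. m i y * walk (S - {x} - {y}) y x)"
          using psubset.IH[OF sub[OF x]] by blast
        moreover have "det_on m (S - {x}) * m i x = m i x * det_on m (S - {x})"
          using psubset.IH[OF sub[OF x]] by (intro real_quat_commute) blast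
        ultimately show "walk (S - {x}) i x * v x = m i x * (det_on m (S - {x}) * v x)
             - (\<Sum>y\<in>S - {x}. m i y * (walk (S - {x} - {y}) y x * v x))"
          by (simp add: left_diff_distrib sum_distrib_right mult.assoc)
      qed
      also have "\<dots> = (\<Sum>y\<in>S. m i y * (det_on m (S - {y}) * v y))
          - (\<Sum>y\<in>S. \<Sum>x\<in>S - {y}. m i y * (walk (S - {y} - {x}) y x * v x))"
        unfolding sum_subtractf
          sum_Diff_swap[OF fin, of "\<lambda>x y. m i y * (walk (S - {x} - {y}) y x * v x)"]
        by (intro arg_cong2[of _ _ _ _ "(-)"] sum.cong refl) (simp only: dc)
      also have "\<dots> = (\<Sum>y\<in>S. m i y * cdet_on m (S - {y}) y v)"
      proof -
        have "m i y * cdet_on m (S - {y}) y v = m i y * (det_on m (S - {y}) * v y)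
            - (\<Sum>x\<in>S - {y}. m i y * (walk (S - {y} - {x}) y x * v x))" for y
          using cdet_on_rec[of "S - {y}" m y v] fin
          by (simp only: finite_Diff right_diff_distrib sum_distrib_left)
        then show ?thesis by (simp only: sum_subtractf)
      qed
      finally show ?thesis unfolding cdet_on_rec[OF fin] by simp
    qed
    have "conjugate (walk S i l) = walk S l i" for i l
    proof -
      have "conjugate (walk S i l) = m l i * det_on m S
          - (\<Sum>x\<in>S. m l x * conjugate (walk (S - {x}) i x))"
        unfolding cdet_on_rec[OF fin] by (simp add: qcnj_diff qcnj_mult qcnj_sum herm real)
      also have "(\<Sum>x\<in>S. m l x * conjugate (walk (S - {x}) i x)) = (\<Sum>x\<in>S. m l x * walk (S - {x}) x i)"
        using psubset.IH[OF sub] by (intro sum.cong[OF refl]) metis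
      also have "m l i * det_on m S - \<dots> = walk S l i"
        unfolding rec[of l "\<lambda>a. m a i"] real_quat_commute[OF real] ..
      finally show ?thesis .
    qed
    with real rec show ?case by blast
  qed
  then show "conjugate (det_on m S) = det_on m S"
    "cdet_on m S i v = det_on m S * v i - (\<Sum>y\<in>S. m i y * cdet_on m (S - {y}) y v)"
    "conjugate (walk S i l) = walk S l i" by blast+
qed

lemma cdet_on_eq_path_sum:
  assumes "finite S"
  shows "cdet_on m S i v = path_sum m (\<lambda>R x. det_on m R * v x) S i"
  using assms
proof (induction S arbitrary: i rule: finite_psubset_induct)
  case (psubset S)
  have "cdet_on m (S - {y}) y v = path_sum m (\<lambda>R x. det_on m R * v x) (S - {y}) y" if "y \<in> S" for y
    using that by (intro psubset.IH) auto
  then show ?case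
    unfolding path_sum_rec[OF psubset.hyps] hermitian_cdet_on(2)[OF psubset.hyps, of i] by simp
qed

text \<open>Both sides sum over pairs of internally disjoint paths, one from \<open>i\<close> to \<open>l\<close> and one from \<open>j\<close> to \<open>k\<close>.  The products
differ by a cyclic rotation only, which the real part does not see.  The factor \<open>c\<close> collects
the steps of the first path that have been peeled off in the induction.\<close>

lemma qre_walk_pair_swap:
  assumes "finite U"
  shows "qre (c * path_sum m (\<lambda>R x. m x l * walk R j k) U i)
    = qre (path_sum m (\<lambda>R x. m x k * (c * walk R i l)) U j)"
  using assms
proof (induction U arbitrary: i c rule: finite_psubset_induct)
  case (psubset U)
  note fin = psubset.hyps
  let ?P = "path_sum m (\<lambda>R x. m x l * walk R j k)"
  let ?Q = "\<lambda>y. path_sum m (\<lambda>R x. m x k * (c * m i y * walk R y l)) (U - {y}) j"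
  have IH: "qre (c * m i y * ?P (U - {y}) y) = qre (?Q y)" if "y \<in> U" for y
    using that by (intro psubset.IH) auto
  have "c * ?P U i = c * m i l * walk U j k - (\<Sum>y\<in>U. c * m i y * ?P (U - {y}) y)"
    unfolding path_sum_rec[OF fin] by (simp add: right_diff_distrib sum_distrib_left mult.assoc)
  then have 1: "qre (c * ?P U i) = qre (c * m i l * walk U j k) - (\<Sum>y\<in>U. qre (?Q y))"
    using IH by (simp add: qre_sum)
  have "path_sum m (\<lambda>R x. m x k * (c * walk R i l)) U j
      = path_sum m (\<lambda>R x. det_on m R * m x k * (c * m i l)
          - (\<Sum>y\<in>R. m x k * (c * m i y * walk (R - {y}) y l))) U j"
  proof (rule path_sum_cong[OF fin])
    fix R x assume "R \<subseteq> U"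
    then have R: "finite R" using fin finite_subset by blast
    have c: "det_on m R * q = q * det_on m R" for q
      by (rule real_quat_commute[OF hermitian_cdet_on(1)[OF R]])
    have "det_on m R * m x k * (c * m i l) = m x k * (c * (det_on m R * m i l))"
      by (metis c mult.assoc)
    then show "m x k * (c * walk R i l) = det_on m R * m x k * (c * m i l)
          - (\<Sum>y\<in>R. m x k * (c * m i y * walk (R - {y}) y l))"
      unfolding hermitian_cdet_on(2)[OF R, of i]
      by (simp add: right_diff_distrib sum_distrib_left mult.assoc)
  qed
  also have "\<dots> = walk U j k * (c * m i l) - (\<Sum>y\<in>U. ?Q y)"
    unfolding path_sum_diff[OF fin] path_sum_mult_right[OF fin]
      path_sum_sum[OF fin, of m "\<lambda>y R x. m x k * (c * m i y * walk R y l)"] cdet_on_eq_path_sum[OF fin] ..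
  finally have "qre (path_sum m (\<lambda>R x. m x k * (c * walk R i l)) U j)
      = qre (walk U j k * (c * m i l)) - (\<Sum>y\<in>U. qre (?Q y))"
    by (simp add: qre_sum)
  then show ?case unfolding 1 by (simp only: qre_mult_commute[of "walk U j k"])
qed

text \<open>All column determinants of a Hermitian matrix agree.  Let \<open>i\<close> and \<open>j\<close> be two vertices and \<open>U\<close> the
remaining ones.  In the determinant along \<open>i\<close>, the cycle of \<open>i\<close> either avoids \<open>j\<close>, and then the
unvisited vertices contribute a cycle through \<open>j\<close>, or it consists of a path from \<open>i\<close> to \<open>j\<close>
and a path from \<open>j\<close> to \<open>i\<close>.  Both kinds of terms are symmetric in \<open>i\<close> and \<open>j\<close> up to rotation.
Since the determinants are real, it suffices to compare real parts.\<close>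

lemma det_on_eq_walk:
  assumes "finite S" "i \<in> S"
  shows "det_on m S = walk (S - {i}) i i"
  using assms
proof (induction S arbitrary: i rule: finite_psubset_induct)
  case (psubset S)
  let ?j = "Min S"
  have j: "?j \<in> S" by (rule Min_in) (use psubset.hyps psubset.prems in auto)
  have D: "det_on m S = walk (S - {?j}) ?j ?j"
    using psubset.prems by (auto simp: det_on_def)
  show ?case
  proof (cases "i = ?j")
    case False
    define U where "U = S - {i} - {?j}"
    have U: "finite U" "i \<notin> U" "?j \<notin> U" using psubset.hyps by (auto simp: U_def)
    have expand: "walk (insert b U) a a = path_sum m (\<lambda>R x. m x a * walk R b b) U a
        - path_sum m (\<lambda>R x. m x b * walk R b a) U a"
      if b: "b \<notin> U" and sub: "insert b U \<subset> S" for a b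
    proof -
      have "walk (insert b U) a a = path_sum m (\<lambda>R x. det_on m (insert b R) * m x a
          - m x b * path_sum m (\<lambda>R x. det_on m R * m x a) R b) U a"
        using U b by (simp add: cdet_on_eq_path_sum path_sum_insert)
      also have "\<dots> = path_sum m (\<lambda>R x. m x a * walk R b b - m x b * walk R b a) U a"
      proof (rule path_sum_cong[OF U(1)])
        fix R x assume R: "R \<subseteq> U"
        then have fR: "finite R" using U(1) finite_subset by blast
        have "det_on m (insert b R) = walk (insert b R - {b}) b b"
          using sub R by (intro psubset.IH) auto
        also have "insert b R - {b} = R" using b R by auto
        finally have "det_on m (insert b R) * m x a = m x a * walk R b b"
          using real_quat_commute[OF hermitian_cdet_on(3)[OF fR]] by simp
        then show "det_on m (insert b R) * m x a - m x b * path_sum m (\<lambda>R x. det_on m R * m x a) R b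
            = m x a * walk R b b - m x b * walk R b a"
          unfolding cdet_on_eq_path_sum[OF fR] by simp
      qed
      finally show ?thesis unfolding path_sum_diff[OF U(1)] .
    qed
    have s1: "S - {i} = insert ?j U" and s2: "S - {?j} = insert i U"
      using False j psubset.prems by (auto simp: U_def)
    have swap: "qre (path_sum m (\<lambda>R x. m x l * walk R b k) U a)
        = qre (path_sum m (\<lambda>R x. m x k * walk R a l) U b)" for a b k l
      using qre_walk_pair_swap[OF U(1), of 1 l b k a] by simp
    have "walk (insert ?j U) i i = walk (insert i U) ?j ?j"
    proof (rule real_quat_eqI)
      show "conjugate (walk (insert ?j U) i i) = walk (insert ?j U) i i"
        "conjugate (walk (insert i U) ?j ?j) = walk (insert i U) ?j ?j"
        using U(1) by (simp_all add: hermitian_cdet_on(3))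
      have "insert ?j U \<subset> S" "insert i U \<subset> S" using s1 s2 psubset.prems j by auto
      then have "walk (insert ?j U) i i = path_sum m (\<lambda>R x. m x i * walk R ?j ?j) U i
          - path_sum m (\<lambda>R x. m x ?j * walk R ?j i) U i"
        "walk (insert i U) ?j ?j = path_sum m (\<lambda>R x. m x ?j * walk R i i) U ?j
          - path_sum m (\<lambda>R x. m x i * walk R i ?j) U ?j"
        using expand[OF U(3)] expand[OF U(2)] by blast+
      then show "qre (walk (insert ?j U) i i) = qre (walk (insert i U) ?j ?j)"
        using swap[of i ?j ?j i] swap[of ?j ?j i i] by simp
    qed
    then show ?thesis unfolding D s1 s2 by simp
  qed (use D in simp)
qed

text \<open>A walk from \<open>i\<close> that ends with a step into \<open>l\<close> either avoids \<open>l\<close> before, and then the unvisited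
vertices contribute a cycle through \<open>l\<close>, or has passed through \<open>l\<close> and closes such a cycle at its
end.  The same configurations arise in both ways, with opposite signs.\<close>

lemma walk_eq_0:
  assumes S: "finite S" "l \<in> S"
  shows "walk S i l = 0"
proof -
  define U where "U = S - {l}"
  have U: "finite U" "l \<notin> U" "S = insert l U" using S by (auto simp: U_def)
  have "walk S i l = path_sum m (\<lambda>R x. det_on m (insert l R) * m x l
          - m x l * path_sum m (\<lambda>R x. det_on m R * m x l) R l) U i"
    using U by (simp add: cdet_on_eq_path_sum path_sum_insert)
  also have "\<dots> = path_sum m (\<lambda>R x. 0) U i"
  proof (rule path_sum_cong[OF U(1)])
    fix R x assume R: "R \<subseteq> U"
    then have fR: "finite R" using U(1) finite_subset by blast
    have "det_on m (insert l R) = walk (insert l R - {l}) l l"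
      using fR by (intro det_on_eq_walk) auto
    also have "insert l R - {l} = R" using U(2) R by auto
    finally have "det_on m (insert l R) * m x l = m x l * walk R l l"
      using real_quat_commute[OF hermitian_cdet_on(3)[OF fR]] by simp
    then show "det_on m (insert l R) * m x l - m x l * path_sum m (\<lambda>R x. det_on m R * m x l) R l = 0"
      unfolding cdet_on_eq_path_sum[OF fR] by simp
  qed
  also have "\<dots> = 0" by (rule path_sum_zero[OF U(1)])
  finally show ?thesis .
qed

end

section \<open>Sums over principal submatrices\<close>

lemma cdet_on_add:
  assumes "finite S"
  shows "cdet_on m S i (\<lambda>a. v a + w a) = cdet_on m S i v + cdet_on m S i w"
  unfolding cdet_on_rec[OF assms, of m i] by (simp add: distrib_left sum.distrib)

lemma cdet_on_mult_right:
  assumes "finite S"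
  shows "cdet_on m S i (\<lambda>a. v a * c) = cdet_on m S i v * c"
  unfolding cdet_on_rec[OF assms, of m i]
  by (simp add: left_diff_distrib sum_distrib_right mult.assoc)

lemma cdet_on_zero: "finite S \<Longrightarrow> cdet_on m S i (\<lambda>a. 0) = 0"
  using cdet_on_mult_right[of S m i "\<lambda>a. 0" 0] by simp

lemma cdet_on_sum:
  assumes "finite S" "finite L"
  shows "cdet_on m S i (\<lambda>a. \<Sum>l\<in>L. f l a * c l) = (\<Sum>l\<in>L. cdet_on m S i (f l) * c l)"
  using assms(2) by (induction L rule: finite_induct)
    (simp_all add: cdet_on_zero cdet_on_add cdet_on_mult_right assms(1))

definition minor_sum :: "(nat \<Rightarrow> nat \<Rightarrow> 'a :: ring_1) \<Rightarrow> nat \<Rightarrow> nat \<Rightarrow> 'a" where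
  "minor_sum m n s = (\<Sum>b\<in>index_sets s n. det_on m b)"

definition cdet_sum :: "(nat \<Rightarrow> nat \<Rightarrow> 'a :: ring_1) \<Rightarrow> nat \<Rightarrow> nat \<Rightarrow> nat \<Rightarrow> (nat \<Rightarrow> 'a) \<Rightarrow> 'a" where
  "cdet_sum m n s i v = (\<Sum>b\<in>index_sets_at s n i. cdet_on m (b - {i}) i v)"

lemma finite_index_sets: "finite (index_sets s n)"
  by (rule finite_subset[of _ "Pow {0..<n}"]) (auto simp: index_sets_def)

lemma finite_mem_index_sets: "b \<in> index_sets s n \<Longrightarrow> finite b"
  by (auto simp: index_sets_def intro: finite_subset)

lemma finite_mem_index_sets_at: "b \<in> index_sets_at s n i \<Longrightarrow> finite b"
  by (auto simp: index_sets_at_def finite_mem_index_sets)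

lemma index_sets_split:
  assumes "i < n"
  shows "index_sets s n = {S. S \<subseteq> {0..<n} - {i} \<and> card S = s} \<union> index_sets_at s n i"
    and "{S. S \<subseteq> {0..<n} - {i} \<and> card S = s} \<inter> index_sets_at s n i = {}"
  using assms by (auto simp: index_sets_def index_sets_at_def)

lemma sum_index_sets_at:
  fixes f :: "nat set \<Rightarrow> 'b :: comm_monoid_add"
  assumes i: "i < n"
  shows "(\<Sum>b\<in>index_sets_at s n i. f (b - {i})) = (\<Sum>S | S \<subseteq> {0..<n} - {i} \<and> Suc (card S) = s. f S)"
proof (rule sum.reindex_bij_witness[where i = "insert i" and j = "\<lambda>b. b - {i}"])
  fix S assume "S \<in> {S. S \<subseteq> {0..<n} - {i} \<and> Suc (card S) = s}"
  then have S: "S \<subseteq> {0..<n} - {i}" "Suc (card S) = s" "finite S" by (auto intro: finite_subset)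
  show "insert i S - {i} = S" using S by auto
  have "card (insert i S) = s" using S by (subst card_insert_disjoint) auto
  then show "insert i S \<in> index_sets_at s n i"
    using S i by (auto simp: index_sets_at_def index_sets_def)
next
  fix b assume b: "b \<in> index_sets_at s n i"
  then have "finite b" by (rule finite_mem_index_sets_at)
  have ib: "i \<in> b" "b \<subseteq> {0..<n}" "card b = s" using b by (auto simp: index_sets_at_def index_sets_def)
  have "Suc (card (b - {i})) = s" using card_Suc_Diff1[OF \<open>finite b\<close> ib(1)] ib(3) by (simp only:)
  then show "b - {i} \<in> {S. S \<subseteq> {0..<n} - {i} \<and> Suc (card S) = s}" using ib by auto
  show "insert i (b - {i}) = b" using ib by auto
qed simp

lemma sum_card_remove:
  fixes f :: "'a set \<Rightarrow> 'a \<Rightarrow> 'b :: comm_monoid_add"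
  assumes N: "finite N"
  shows "(\<Sum>S | S \<subseteq> N \<and> card S = s. \<Sum>x\<in>S. f (S - {x}) x)
    = (\<Sum>S | S \<subseteq> N \<and> Suc (card S) = s. \<Sum>x\<in>N - S. f S x)"
proof -
  have fin: "finite S" if "S \<subseteq> N" for S using N that finite_subset by blast
  have "(\<Sum>S | S \<subseteq> N \<and> card S = s. \<Sum>x\<in>S. f (S - {x}) x)
      = (\<Sum>(S, x)\<in>Sigma {S. S \<subseteq> N \<and> card S = s} (\<lambda>S. S). f (S - {x}) x)"
  proof (rule sum.Sigma)
    show "finite {S. S \<subseteq> N \<and> card S = s}" using N by simp
    show "\<forall>S\<in>{S. S \<subseteq> N \<and> card S = s}. finite S" using fin by blast
  qed
  also have "\<dots> = (\<Sum>(S, x)\<in>Sigma {S. S \<subseteq> N \<and> Suc (card S) = s} (\<lambda>S. N - S). f S x)"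
  proof (rule sum.reindex_bij_witness[where i = "\<lambda>(S, x). (insert x S, x)" and j = "\<lambda>(S, x). (S - {x}, x)"])
    fix a assume a: "a \<in> Sigma {S. S \<subseteq> N \<and> card S = s} (\<lambda>S. S)"
    then obtain S x where S: "a = (S, x)" "S \<subseteq> N" "card S = s" "x \<in> S" by auto
    have "Suc (card (S - {x})) = s" using card_Suc_Diff1[OF fin[OF S(2)] S(4)] S(3) by (simp only:)
    then show "(case a of (S, x) \<Rightarrow> (S - {x}, x)) \<in> Sigma {S. S \<subseteq> N \<and> Suc (card S) = s} (\<lambda>S. N - S)"
      using S by auto
    show "(case (case a of (S, x) \<Rightarrow> (S - {x}, x)) of (S, x) \<Rightarrow> (insert x S, x)) = a"
      using S by auto
    show "(case (case a of (S, x) \<Rightarrow> (S - {x}, x)) of (S, x) \<Rightarrow> f S x) = (case a of (S, x) \<Rightarrow> f (S - {x}) x)"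
      using S by simp
  next
    fix a assume a: "a \<in> Sigma {S. S \<subseteq> N \<and> Suc (card S) = s} (\<lambda>S. N - S)"
    then obtain S x where S: "a = (S, x)" "S \<subseteq> N" "Suc (card S) = s" "x \<in> N" "x \<notin> S" by auto
    then have "card (insert x S) = s" using fin by simp
    then show "(case a of (S, x) \<Rightarrow> (insert x S, x)) \<in> Sigma {S. S \<subseteq> N \<and> card S = s} (\<lambda>S. S)"
      using S by auto
    show "(case (case a of (S, x) \<Rightarrow> (insert x S, x)) of (S, x) \<Rightarrow> (S - {x}, x)) = a"
      using S by auto
  qed
  also have "\<dots> = (\<Sum>S | S \<subseteq> N \<and> Suc (card S) = s. \<Sum>x\<in>N - S. f S x)"
  proof (rule sum.Sigma[symmetric])
    show "finite {S. S \<subseteq> N \<and> Suc (card S) = s}" using N by simp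
    show "\<forall>S\<in>{S. S \<subseteq> N \<and> Suc (card S) = s}. finite (N - S)" using N by blast
  qed
  finally show ?thesis .
qed

lemma cdet_sum_Suc:
  assumes i: "i < n"
  shows "cdet_sum m n (Suc s) i v = (\<Sum>S | S \<subseteq> {0..<n} - {i} \<and> card S = s. cdet_on m S i v)"
  unfolding cdet_sum_def sum_index_sets_at[OF i, of "\<lambda>S. cdet_on m S i v"]
  by (simp only: nat.inject)

lemma cdet_sum_0: "cdet_sum m n 0 i v = 0"
proof -
  have "index_sets_at 0 n i = {}"
  proof (rule equals0I)
    fix b assume b: "b \<in> index_sets_at 0 n i"
    then have ib: "i \<in> b" "card b = 0" by (auto simp only: index_sets_at_def index_sets_def mem_Collect_eq)
    have "b = {}" using ib(2) finite_mem_index_sets_at[OF b] by (simp only: card_0_eq)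
    then show False using ib(1) by (simp only: empty_iff)
  qed
  then show ?thesis by (simp add: cdet_sum_def)
qed

lemma index_sets_empty: "n < s \<Longrightarrow> index_sets s n = {}"
proof -
  assume s: "n < s"
  show "index_sets s n = {}"
  proof (rule equals0I)
    fix b assume "b \<in> index_sets s n"
    then have b: "b \<subseteq> {0..<n}" "card b = s" by (simp_all only: index_sets_def mem_Collect_eq)
    have "card b \<le> n" using card_mono[OF finite_atLeastLessThan b(1)] by (simp only: card_atLeastLessThan diff_zero)
    then show False using b(2) s by simp
  qed
qed

lemma cdet_sum_gt: "n < s \<Longrightarrow> cdet_sum m n s i v = 0"
  by (simp add: cdet_sum_def index_sets_at_def index_sets_empty)

lemma minor_sum_gt: "n < s \<Longrightarrow> minor_sum m n s = 0"
  by (simp add: minor_sum_def index_sets_empty)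

lemma minor_sum_0: "minor_sum m n 0 = 1"
proof -
  have "index_sets 0 n = {{}}"
  proof (intro equalityI subsetI)
    fix b assume b: "b \<in> index_sets 0 n"
    then have "card b = 0" by (simp only: index_sets_def mem_Collect_eq)
    then have "b = {}" using finite_mem_index_sets[OF b] by (simp only: card_0_eq)
    then show "b \<in> {{}}" by (simp only: singleton_iff)
  qed (simp add: index_sets_def)
  then show ?thesis by (simp add: minor_sum_def det_on_def)
qed

lemma cdet_sum_sum:
  assumes "finite L"
  shows "cdet_sum m n s i (\<lambda>a. \<Sum>l\<in>L. f l a * c l) = (\<Sum>l\<in>L. cdet_sum m n s i (f l) * c l)"
proof -
  have "cdet_on m (b - {i}) i (\<lambda>a. \<Sum>l\<in>L. f l a * c l) = (\<Sum>l\<in>L. cdet_on m (b - {i}) i (f l) * c l)"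
    if "b \<in> index_sets_at s n i" for b
    using finite_mem_index_sets_at[OF that] assms by (intro cdet_on_sum) auto
  then show ?thesis unfolding cdet_sum_def sum_distrib_right
    by (subst sum.swap) (rule sum.cong[OF refl])
qed

lemma cdet_sum_cong:
  assumes "\<And>x. x < n \<Longrightarrow> v x = w x"
  shows "cdet_sum m n s i v = cdet_sum m n s i w"
  unfolding cdet_sum_def
proof (rule sum.cong[OF refl])
  fix b assume b: "b \<in> index_sets_at s n i"
  then show "cdet_on m (b - {i}) i v = cdet_on m (b - {i}) i w"
    using assms finite_mem_index_sets_at[OF b]
    by (intro cdet_on_cong) (auto simp: index_sets_at_def index_sets_def)
qed

text \<open>Each \<open>S\<close> of size \<open>s\<close> occurs once for every \<open>i\<close> outside of \<open>S\<close>.  This is the trace of the adjugate of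
index \<open>s + 1\<close>.\<close>

lemma sum_cdet_sum_diagonal:
  "(\<Sum>i<n. cdet_sum m n (Suc s) i (\<lambda>a. if a = i then 1 else 0)) = of_nat (n - s) * minor_sum m n s"
proof -
  have "cdet_sum m n (Suc s) i (\<lambda>a. if a = i then 1 else 0)
      = (\<Sum>S\<in>{S \<in> index_sets s n. i \<notin> S}. det_on m S)" if "i < n" for i
  proof -
    have "cdet_on m S i (\<lambda>a. if a = i then 1 else 0) = det_on m S" if "S \<subseteq> {0..<n} - {i}" for S
    proof -
      have S: "finite S" using that by (rule finite_subset) simp
      have "(\<Sum>x\<in>S. cdet_on m (S - {x}) i (\<lambda>a. m a x) * (if x = i then 1 else 0)) = 0"
        using that by (intro sum.neutral) auto
      then show ?thesis unfolding cdet_on_rec[OF S, of m i] by simp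
    qed
    moreover have "{S. S \<subseteq> {0..<n} - {i} \<and> card S = s} = {S \<in> index_sets s n. i \<notin> S}"
      by (auto simp: index_sets_def)
    ultimately show ?thesis unfolding cdet_sum_Suc[OF that] by (intro sum.cong) blast+
  qed
  then have "(\<Sum>i<n. cdet_sum m n (Suc s) i (\<lambda>a. if a = i then 1 else 0))
      = (\<Sum>i<n. \<Sum>S\<in>{S \<in> index_sets s n. i \<notin> S}. det_on m S)" by simp
  also have "\<dots> = (\<Sum>S\<in>index_sets s n. \<Sum>i\<in>{i \<in> {..<n}. i \<notin> S}. det_on m S)"
    by (rule sum.swap_restrict) (simp_all add: finite_index_sets)
  also have "\<dots> = (\<Sum>S\<in>index_sets s n. of_nat (n - s) * det_on m S)"
  proof (rule sum.cong[OF refl])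
    fix S assume S: "S \<in> index_sets s n"
    have "{i \<in> {..<n}. i \<notin> S} = {0..<n} - S" by auto
    also have "card \<dots> = n - s"
      using S finite_mem_index_sets[OF S] by (subst card_Diff_subset) (auto simp: index_sets_def)
    finally show "(\<Sum>i\<in>{i \<in> {..<n}. i \<notin> S}. det_on m S) = of_nat (n - s) * det_on m S" by simp
  qed
  finally show ?thesis by (simp add: minor_sum_def sum_distrib_left)
qed

context hermitian_entries
begin

lemma minor_sum_real: "conjugate (minor_sum m n s) = minor_sum m n s"
  unfolding minor_sum_def qcnj_sum
  using hermitian_cdet_on(1) finite_mem_index_sets by (intro sum.cong[OF refl]) blast

text \<open>The term \<open>c\<^sub>s(H y)\<close> is a combination of the replaced columns \<open>l\<close>.  Those with \<open>l\<close> in the index set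
vanish, \<open>l = i\<close> gives the principal minors that contain \<open>i\<close>, and the others cancel against the
cofactor expansion of \<open>c\<^sub>s\<^sub>+\<^sub>1(y)\<close>, of which only the principal minors without \<open>i\<close> remain.\<close>

lemma minor_sum_mult:
  assumes i: "i < n"
  shows "minor_sum m n s * y i
    = cdet_sum m n (Suc s) i y + cdet_sum m n s i (\<lambda>x. \<Sum>l<n. m x l * y l)"
proof -
  let ?N = "{0..<n} - {i}"
  let ?K = "{S. S \<subseteq> ?N \<and> card S = s}" and ?K' = "{S. S \<subseteq> ?N \<and> Suc (card S) = s}"
  have N: "finite ?N" by simp
  have fin: "finite S" if "S \<subseteq> ?N" for S using that N by (rule finite_subset)
  have D: "minor_sum m n s = (\<Sum>S\<in>?K. det_on m S) + (\<Sum>S\<in>?K'. walk S i i)"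
  proof -
    have "minor_sum m n s = (\<Sum>S\<in>?K. det_on m S) + (\<Sum>b\<in>index_sets_at s n i. det_on m b)"
      unfolding minor_sum_def index_sets_split(1)[OF i, of s]
    proof (rule sum.union_disjoint[OF _ _ index_sets_split(2)[OF i]])
      have "finite (?K \<union> index_sets_at s n i)"
        unfolding index_sets_split(1)[OF i, symmetric] by (rule finite_index_sets)
      then show "finite ?K" "finite (index_sets_at s n i)" by (simp_all only: finite_Un)
    qed
    also have "(\<Sum>b\<in>index_sets_at s n i. det_on m b) = (\<Sum>b\<in>index_sets_at s n i. walk (b - {i}) i i)"
      using finite_mem_index_sets_at by (intro sum.cong[OF refl] det_on_eq_walk) (auto simp: index_sets_at_def)
    also have "\<dots> = (\<Sum>S\<in>?K'. walk S i i)" by (rule sum_index_sets_at[OF i])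
    finally show ?thesis .
  qed
  have "cdet_sum m n (Suc s) i y = (\<Sum>S\<in>?K. det_on m S * y i - (\<Sum>x\<in>S. walk (S - {x}) i x * y x))"
    unfolding cdet_sum_Suc[OF i] using fin by (intro sum.cong[OF refl] cdet_on_rec) auto
  also have "\<dots> = (\<Sum>S\<in>?K. det_on m S * y i) - (\<Sum>S\<in>?K'. \<Sum>x\<in>?N - S. walk S i x * y x)"
    unfolding sum_subtractf sum_card_remove[OF N, of "\<lambda>S x. walk S i x * y x" s] ..
  finally have 1: "cdet_sum m n (Suc s) i y
      = (\<Sum>S\<in>?K. det_on m S * y i) - (\<Sum>S\<in>?K'. \<Sum>x\<in>?N - S. walk S i x * y x)" .
  have "cdet_sum m n s i (\<lambda>x. \<Sum>l<n. m x l * y l)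
      = (\<Sum>S\<in>?K'. cdet_on m S i (\<lambda>x. \<Sum>l<n. m x l * y l))"
    unfolding cdet_sum_def by (rule sum_index_sets_at[OF i])
  also have "\<dots> = (\<Sum>S\<in>?K'. walk S i i * y i + (\<Sum>x\<in>?N - S. walk S i x * y x))"
  proof (rule sum.cong[OF refl])
    fix S assume "S \<in> ?K'"
    then have S: "S \<subseteq> ?N" "finite S" using fin by auto
    have "cdet_on m S i (\<lambda>x. \<Sum>l<n. m x l * y l) = (\<Sum>l<n. walk S i l * y l)"
      using cdet_on_sum[OF S(2), of "{..<n}" m i "\<lambda>l a. m a l" y] by simp
    also have "\<dots> = (\<Sum>l\<in>insert i (?N - S). walk S i l * y l)"
      using walk_eq_0[OF S(2)] i by (intro sum.mono_neutral_right) auto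
    also have "\<dots> = walk S i i * y i + (\<Sum>x\<in>?N - S. walk S i x * y x)"
      by (subst sum.insert) auto
    finally show "cdet_on m S i (\<lambda>x. \<Sum>l<n. m x l * y l)
        = walk S i i * y i + (\<Sum>x\<in>?N - S. walk S i x * y x)" .
  qed
  finally show ?thesis unfolding 1 D by (simp add: sum.distrib distrib_right sum_distrib_right)
qed

end

section \<open>Trace, powers and kernels of quaternion matrices\<close>

lemma mult_mat_assoc:
  "dim_col A = dim_row B \<Longrightarrow> dim_col B = dim_row C \<Longrightarrow> (A * B) * C = A * (B * (C :: 'a :: semiring_0 mat))"
  by (rule assoc_mult_mat[of _ "dim_row A" "dim_row B" _ "dim_row C" _ "dim_col C"]) auto

lemma smult_mult_mat:
  "dim_col A = dim_row B \<Longrightarrow> (k \<cdot>\<^sub>m A) * B = k \<cdot>\<^sub>m (A * (B :: 'a :: ring mat))"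
  by (rule eq_matI) (auto simp: scalar_prod_def sum_distrib_left mult.assoc)

lemma mult_smult_real_mat:
  fixes A B :: "quat mat"
  assumes "conjugate k = k" "dim_col A = dim_row B"
  shows "A * (k \<cdot>\<^sub>m B) = k \<cdot>\<^sub>m (A * B)"
proof (rule eq_matI)
  fix i j assume ij: "i < dim_row (k \<cdot>\<^sub>m (A * B))" "j < dim_col (k \<cdot>\<^sub>m (A * B))"
  have "a * (k * b) = k * (a * b)" for a b
    by (metis real_quat_commute[OF assms(1)] mult.assoc)
  then show "(A * (k \<cdot>\<^sub>m B)) $$ (i, j) = (k \<cdot>\<^sub>m (A * B)) $$ (i, j)"
    using ij assms(2) by (simp add: scalar_prod_def sum_distrib_left)
qed auto

definition mat_trace :: "'a :: comm_monoid_add mat \<Rightarrow> 'a" where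
  "mat_trace M = (\<Sum>i<dim_row M. M $$ (i, i))"

text \<open>Over the quaternions the trace of a product depends on the order of the factors, but its real
part does not.\<close>

lemma qre_trace_mult_commute:
  fixes A B :: "quat mat"
  assumes "A \<in> carrier_mat n d" "B \<in> carrier_mat d n"
  shows "qre (mat_trace (A * B)) = qre (mat_trace (B * A))"
proof -
  have d: "dim_row A = n" "dim_col A = d" "dim_row B = d" "dim_col B = n" using assms by auto
  have "qre (mat_trace (A * B)) = (\<Sum>i<n. \<Sum>k<d. qre (A $$ (i, k) * B $$ (k, i)))"
    by (simp add: mat_trace_def d scalar_prod_def qre_sum atLeast0LessThan)
  also have "\<dots> = (\<Sum>k<d. \<Sum>i<n. qre (B $$ (k, i) * A $$ (i, k)))"
    by (subst sum.swap) (simp only: qre_mult_commute)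
  also have "\<dots> = qre (mat_trace (B * A))"
    by (simp add: mat_trace_def d scalar_prod_def qre_sum atLeast0LessThan)
  finally show ?thesis .
qed

lemma conj_transpose_dim [simp]:
  "dim_row (conj_transpose M) = dim_col M" "dim_col (conj_transpose M) = dim_row M"
  by (simp_all add: conj_transpose_def)

lemma conj_transpose_index [simp]:
  "i < dim_col M \<Longrightarrow> j < dim_row M \<Longrightarrow> conj_transpose M $$ (i, j) = conjugate (M $$ (j, i))"
  by (simp add: conj_transpose_def)

lemma conj_transpose_mult:
  fixes A B :: "quat mat"
  assumes "dim_col A = dim_row B"
  shows "conj_transpose (A * B) = conj_transpose B * conj_transpose A"
  using assms by (intro eq_matI) (auto simp: scalar_prod_def qcnj_sum qcnj_mult)

lemma hermitian_mat_square: "hermitian_mat M \<Longrightarrow> dim_row M = dim_col M"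
  unfolding hermitian_mat_def by (metis conj_transpose_dim(1))

lemma hermitian_mat_index:
  "hermitian_mat M \<Longrightarrow> i < dim_row M \<Longrightarrow> j < dim_row M \<Longrightarrow> conjugate (M $$ (i, j)) = M $$ (j, i)"
  using hermitian_mat_square[of M] unfolding hermitian_mat_def by (metis conj_transpose_index)

lemma pow_mat_commute:
  fixes B :: "'a :: semiring_1 mat"
  assumes "H \<in> carrier_mat n n" "B \<in> carrier_mat n n" "B * H = H * B"
  shows "B * H ^\<^sub>m t = H ^\<^sub>m t * B"
proof (induction t)
  case (Suc t)
  have d: "dim_row H = n" "dim_col H = n" "dim_row B = n" "dim_col B = n" using assms by auto
  have "B * H ^\<^sub>m Suc t = (B * H ^\<^sub>m t) * H" using d by (simp add: mult_mat_assoc del: assoc_mult_mat)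
  also have "\<dots> = H ^\<^sub>m t * (B * H)" unfolding Suc using d by (simp add: mult_mat_assoc del: assoc_mult_mat)
  also have "\<dots> = H ^\<^sub>m Suc t * B" unfolding assms(3) using d by (simp add: mult_mat_assoc del: assoc_mult_mat)
  finally show ?case .
qed (use assms in simp)

lemma pow_mat_Suc_left:
  "H \<in> carrier_mat n n \<Longrightarrow> H ^\<^sub>m Suc t = H * (H :: 'a :: semiring_1 mat) ^\<^sub>m t"
  using pow_mat_commute[of H n H t] by simp

lemma hermitian_mat_pow:
  fixes H :: "quat mat"
  assumes "hermitian_mat H"
  shows "hermitian_mat (H ^\<^sub>m t)"
proof (induction t)
  case 0
  show ?case unfolding hermitian_mat_def
    by (rule eq_matI) (auto simp: qcnj_one qcnj_zero)
next
  case (Suc t)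
  have sq: "H \<in> carrier_mat (dim_row H) (dim_row H)"
    using hermitian_mat_square[OF assms] by auto
  have "conj_transpose (H ^\<^sub>m Suc t) = conj_transpose H * conj_transpose (H ^\<^sub>m t)"
    unfolding pow_mat.simps
    by (rule conj_transpose_mult) (simp only: pow_mat_dim_square(2)[OF sq])
  also have "\<dots> = H ^\<^sub>m Suc t"
    unfolding pow_mat_Suc_left[OF sq] using Suc assms by (simp only: hermitian_mat_def)
  finally show ?case by (simp only: hermitian_mat_def)
qed

lemma conj_transpose_mult_self_eq_0:
  fixes M :: "quat mat"
  assumes M: "M \<in> carrier_mat n d" and 0: "conj_transpose M * M = 0\<^sub>m d d"
  shows "M = 0\<^sub>m n d"
proof (rule eq_matI)
  fix i j assume "i < dim_row (0\<^sub>m n d :: quat mat)" "j < dim_col (0\<^sub>m n d :: quat mat)"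
  then have ij: "i < n" "j < d" by auto
  let ?sq = "\<lambda>q. (qre q)\<^sup>2 + (qi q)\<^sup>2 + (qj q)\<^sup>2 + (qk q)\<^sup>2"
  have "qre ((conj_transpose M * M) $$ (j, j)) = (\<Sum>k\<in>{0..<n}. ?sq (M $$ (k, j)))"
    using M ij by (simp add: scalar_prod_def qre_sum quat_times_sel power2_eq_square)
  then have "(\<Sum>k\<in>{0..<n}. ?sq (M $$ (k, j))) = 0" unfolding 0 using ij by simp
  then have "\<forall>k\<in>{0..<n}. ?sq (M $$ (k, j)) = 0"
    by (subst (asm) sum_nonneg_eq_0_iff) simp_all
  then have "?sq (M $$ (i, j)) = 0" using ij(1) by simp
  then have "M $$ (i, j) = 0" using quat_norm_pos[of "M $$ (i, j)"] by fastforce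
  then show "M $$ (i, j) = 0\<^sub>m n d $$ (i, j)" using ij by simp
qed (use M in auto)

text \<open>Positive definiteness of \<open>M\<^sup>* M\<close> gives \<open>ker H\<^sup>2 = ker H\<close>, and this descends from any power.\<close>

lemma hermitian_pow_mult_eq_0:
  fixes H :: "quat mat"
  assumes H: "H \<in> carrier_mat n n" "hermitian_mat H"
    and Y: "Y \<in> carrier_mat n d" and 0: "H ^\<^sub>m t * Y = 0\<^sub>m n d"
  shows "H * Y = 0\<^sub>m n d"
  using Y 0
proof (induction t arbitrary: Y)
  case 0
  then have "Y = 0\<^sub>m n d" using H by simp
  then show ?case using H by simp
next
  case (Suc t)
  have d: "dim_row H = n" "dim_col H = n" "dim_row Y = n" "dim_col Y = d" using H Suc.prems by auto
  have "H ^\<^sub>m t * (H * Y) = 0\<^sub>m n d"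
    using Suc.prems d by (simp add: mult_mat_assoc del: assoc_mult_mat)
  then have HHY: "H * (H * Y) = 0\<^sub>m n d" using Suc.IH[of "H * Y"] H Suc.prems by simp
  have "conj_transpose (H * Y) * (H * Y) = conj_transpose Y * (H * (H * Y))"
    using H(2) d by (simp add: conj_transpose_mult hermitian_mat_def mult_mat_assoc del: assoc_mult_mat)
  also have "\<dots> = 0\<^sub>m d d" unfolding HHY using d by (intro eq_matI) (auto simp: scalar_prod_def)
  finally show ?case using H Suc.prems by (intro conj_transpose_mult_self_eq_0[of _ n d]) auto
qed

section \<open>Adjugates and the inner inverse of a Hermitian matrix\<close>

text \<open>The entries are extended by zero, so that Hermitian symmetry holds for all pairs of indices.\<close>

definition entry :: "'a :: zero mat \<Rightarrow> nat \<Rightarrow> nat \<Rightarrow> 'a" where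
  "entry H x y = (if x < dim_row H \<and> y < dim_row H then H $$ (x, y) else 0)"

lemma hermitian_entries_entry:
  "hermitian_mat H \<Longrightarrow> hermitian_entries (entry H)"
  by unfold_locales (auto simp: entry_def hermitian_mat_index qcnj_zero)

text \<open>The sum of the adjugates of the principal submatrices of size \<open>s\<close>.  As in the
Faddeev-LeVerrier scheme, these are the coefficients of the adjugate of \<open>t I + H\<close> as a polynomial
in \<open>t\<close>.\<close>

definition adj_sum :: "'a :: ring_1 mat \<Rightarrow> nat \<Rightarrow> 'a mat" where
  "adj_sum H s = mat (dim_row H) (dim_row H)
     (\<lambda>(i, l). cdet_sum (entry H) (dim_row H) s i (\<lambda>a. if a = l then 1 else 0))"

lemma adj_sum_dim [simp]:
  "dim_row (adj_sum H s) = dim_row H" "dim_col (adj_sum H s) = dim_row H"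
  by (simp_all add: adj_sum_def)

lemma adj_sum_mult_index:
  assumes "dim_row B = dim_row H" "i < dim_row H" "j < dim_col B"
  shows "(adj_sum H s * B) $$ (i, j) = cdet_sum (entry H) (dim_row H) s i (\<lambda>x. B $$ (x, j))"
proof -
  let ?n = "dim_row H"
  have "(adj_sum H s * B) $$ (i, j)
      = (\<Sum>l<?n. cdet_sum (entry H) ?n s i (\<lambda>a. if a = l then 1 else 0) * B $$ (l, j))"
    using assms by (simp add: scalar_prod_def adj_sum_def atLeast0LessThan)
  also have "\<dots> = cdet_sum (entry H) ?n s i (\<lambda>a. \<Sum>l<?n. (if a = l then 1 else 0) * B $$ (l, j))"
    by (rule cdet_sum_sum[symmetric]) simp
  also have "\<dots> = cdet_sum (entry H) ?n s i (\<lambda>x. B $$ (x, j))"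
    by (rule cdet_sum_cong) (simp add: if_distrib[of "\<lambda>z. z * _"] cong: if_cong)
  finally show ?thesis .
qed

text \<open>The identity \<open>minor_sum_mult\<close> for the unit vectors \<open>y\<close>.\<close>

lemma adj_sum_rec:
  fixes H :: "quat mat"
  assumes "hermitian_mat H"
  shows "minor_sum (entry H) (dim_row H) s \<cdot>\<^sub>m 1\<^sub>m (dim_row H) = adj_sum H (Suc s) + adj_sum H s * H"
proof (rule eq_matI)
  let ?n = "dim_row H"
  interpret hermitian_entries "entry H" by (rule hermitian_entries_entry[OF assms])
  note sq = hermitian_mat_square[OF assms]
  fix i j assume "i < dim_row (adj_sum H (Suc s) + adj_sum H s * H)" "j < dim_col (adj_sum H (Suc s) + adj_sum H s * H)"
  then have ij: "i < ?n" "j < ?n" using sq by auto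
  have "cdet_sum (entry H) ?n s i (\<lambda>x. \<Sum>l<?n. entry H x l * (if l = j then 1 else 0))
      = (adj_sum H s * H) $$ (i, j)"
    unfolding adj_sum_mult_index[OF refl ij(1) ij(2)[unfolded sq]]
    by (rule cdet_sum_cong) (simp add: ij entry_def if_distrib[of "\<lambda>z. _ * z"] cong: if_cong)
  then show "(minor_sum (entry H) ?n s \<cdot>\<^sub>m 1\<^sub>m ?n) $$ (i, j) = (adj_sum H (Suc s) + adj_sum H s * H) $$ (i, j)"
    using minor_sum_mult[OF ij(1), of s "\<lambda>l. if l = j then 1 else 0"] ij sq
    by (simp add: adj_sum_def)
qed (use hermitian_mat_square[OF assms] in auto)

lemma adj_sum_0: "adj_sum H 0 = 0\<^sub>m (dim_row H) (dim_row H)"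
  by (rule eq_matI) (auto simp: adj_sum_def cdet_sum_0)

lemma adj_sum_gt: "dim_row H < s \<Longrightarrow> adj_sum H s = 0\<^sub>m (dim_row H) (dim_row H)"
  by (rule eq_matI) (auto simp: adj_sum_def cdet_sum_gt)

lemma adj_sum_Suc:
  fixes H :: "quat mat"
  assumes "hermitian_mat H"
  shows "adj_sum H (Suc s) = minor_sum (entry H) (dim_row H) s \<cdot>\<^sub>m 1\<^sub>m (dim_row H) - adj_sum H s * H"
  unfolding adj_sum_rec[OF assms] using hermitian_mat_square[OF assms] by (intro eq_matI) auto

lemma adj_sum_commute:
  fixes H :: "quat mat"
  assumes "hermitian_mat H"
  shows "adj_sum H s * H = H * adj_sum H s"
proof (induction s)
  case 0
  show ?case unfolding adj_sum_0 using hermitian_mat_square[OF assms]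
    by (intro eq_matI) (auto simp: scalar_prod_def)
next
  case (Suc s)
  let ?n = "dim_row H" and ?d = "minor_sum (entry H) (dim_row H) s"
  interpret hermitian_entries "entry H" by (rule hermitian_entries_entry[OF assms])
  note sq = hermitian_mat_square[OF assms]
  have c: "H \<in> carrier_mat ?n ?n" "?d \<cdot>\<^sub>m 1\<^sub>m ?n \<in> carrier_mat ?n ?n" "adj_sum H s * H \<in> carrier_mat ?n ?n"
    using sq by auto
  have "adj_sum H (Suc s) * H = (?d \<cdot>\<^sub>m 1\<^sub>m ?n) * H - adj_sum H s * H * H"
    unfolding adj_sum_Suc[OF assms] by (rule minus_mult_distrib_mat[OF c(2,3,1)])
  also have "(?d \<cdot>\<^sub>m 1\<^sub>m ?n) * H = H * (?d \<cdot>\<^sub>m 1\<^sub>m ?n)"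
    using sq by (simp add: smult_mult_mat mult_smult_real_mat[OF minor_sum_real])
  also have "adj_sum H s * H * H = (H * adj_sum H s) * H" by (simp only: Suc)
  also have "\<dots> = H * (adj_sum H s * H)"
    using sq by (simp add: mult_mat_assoc del: assoc_mult_mat)
  also have "H * (?d \<cdot>\<^sub>m 1\<^sub>m ?n) - H * (adj_sum H s * H) = H * adj_sum H (Suc s)"
    unfolding adj_sum_Suc[OF assms] by (rule mult_minus_distrib_mat[OF c(1,2,3), symmetric])
  finally show ?case .
qed

lemma trace_adj_sum_mult:
  fixes H :: "quat mat"
  assumes H: "hermitian_mat H" and s: "s \<le> dim_row H"
  shows "mat_trace (adj_sum H s * H) = of_nat s * minor_sum (entry H) (dim_row H) s"
proof -
  let ?n = "dim_row H" and ?d = "minor_sum (entry H) (dim_row H) s"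
  note sq = hermitian_mat_square[OF H]
  have "of_nat ?n * ?d = mat_trace (?d \<cdot>\<^sub>m 1\<^sub>m ?n)"
    by (simp add: mat_trace_def)
  also have "\<dots> = mat_trace (adj_sum H (Suc s)) + mat_trace (adj_sum H s * H)"
    unfolding adj_sum_rec[OF H] mat_trace_def using sq
    by (simp add: sum.distrib)
  also have "mat_trace (adj_sum H (Suc s)) = of_nat (?n - s) * ?d"
    using sum_cdet_sum_diagonal[of "entry H" ?n s] by (simp add: mat_trace_def adj_sum_def)
  finally have "mat_trace (adj_sum H s * H) = of_nat ?n * ?d - of_nat (?n - s) * ?d" by simp
  also have "\<dots> = of_nat s * ?d" using s by (simp add: of_nat_diff left_diff_distrib)
  finally show ?thesis .
qed

text \<open>The index \<open>r\<close> is the largest one with nonzero minor sum, and \<open>A = adj\<^sub>r / d\<^sub>r\<close>.  That \<open>r\<close> is the rank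
is expressed by the trace of the idempotent \<open>A H\<close>.  For \<open>r = n\<close> the matrix is invertible, because
\<open>adj\<^sub>n\<^sub>+\<^sub>1\<close> is an empty sum.\<close>

lemma hermitian_inner_inverse:
  fixes H :: "quat mat"
  assumes H: "H \<in> carrier_mat n n" "hermitian_mat H"
  obtains r A where "r \<le> n" "minor_sum (entry H) n r \<noteq> 0"
    "adj_sum H (Suc r) * H = 0\<^sub>m n n"
    "A \<in> carrier_mat n n" "A * H = H * A" "H * A * H = H"
    "mat_trace (A * H) = of_nat r" "r = n \<Longrightarrow> A * H = 1\<^sub>m n"
proof -
  let ?d = "minor_sum (entry H) n"
  interpret hermitian_entries "entry H" by (rule hermitian_entries_entry[OF H(2)])
  have dim: "dim_row H = n" "dim_col H = n" using H by auto
  note rec = adj_sum_rec[OF H(2), unfolded dim]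
  let ?R = "{s. ?d s \<noteq> 0}"
  have R: "?R \<subseteq> {..n}" using minor_sum_gt[of n _ "entry H"] by (auto simp: not_le[symmetric])
  have "0 \<in> ?R" by (simp add: minor_sum_0)
  have finR: "finite ?R" using R finite_subset by blast
  define r where "r = Max ?R"
  have "r \<in> ?R" unfolding r_def using finR \<open>0 \<in> ?R\<close> by (intro Max_in) auto
  then have r: "?d r \<noteq> 0" "r \<le> n" using R by auto
  have d0: "?d s = 0" if "r < s" for s
    using Max_ge[OF finR, of s] that unfolding r_def by force
  \<comment> \<open>The recursion trades a power of \<open>H\<close> for a larger index, until the index exceeds \<open>n\<close>.\<close>
  have adj0: "adj_sum H s * H ^\<^sub>m t = 0\<^sub>m n n" if "r < s" "n < s + t" for s t
    using that
  proof (induction t arbitrary: s)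
    case 0
    then show ?case using adj_sum_gt[of H s] dim by simp
  next
    case (Suc t)
    have step: "adj_sum H (Suc s) = - (adj_sum H s * H)"
      unfolding adj_sum_Suc[OF H(2)] dim d0[OF Suc.prems(1)] using dim by (intro eq_matI) auto
    have "adj_sum H s * H ^\<^sub>m Suc t = (adj_sum H s * H) * H ^\<^sub>m t"
      unfolding pow_mat_Suc_left[OF H(1)] using dim by (simp add: mult_mat_assoc del: assoc_mult_mat)
    also have "\<dots> = - (adj_sum H (Suc s) * H ^\<^sub>m t)"
      unfolding step using dim by (intro eq_matI) (auto simp: scalar_prod_def sum_negf)
    also have "\<dots> = 0\<^sub>m n n"
      using Suc.IH[of "Suc s"] Suc.prems by (intro eq_matI) simp_all
    finally show ?case .
  qed
  have adjH: "adj_sum H (Suc r) * H = 0\<^sub>m n n"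
  proof -
    have "H ^\<^sub>m n * adj_sum H (Suc r) = adj_sum H (Suc r) * H ^\<^sub>m n"
      by (rule pow_mat_commute[OF H(1) _ adj_sum_commute[OF H(2)], symmetric]) (use dim in auto)
    also have "\<dots> = 0\<^sub>m n n" by (rule adj0) auto
    finally have "H * adj_sum H (Suc r) = 0\<^sub>m n n"
      by (intro hermitian_pow_mult_eq_0[OF H]) (use dim in auto)
    then show ?thesis unfolding adj_sum_commute[OF H(2)] .
  qed
  define A where "A = inverse (?d r) \<cdot>\<^sub>m adj_sum H r"
  have real: "conjugate (inverse (?d r)) = inverse (?d r)"
    using minor_sum_real[of n r] unfolding real_quat_iff by (simp add: inverse_quat_def Let_def)
  have inv: "inverse (?d r) \<cdot>\<^sub>m (?d r \<cdot>\<^sub>m M) = M" for M :: "quat mat"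
    using r by (intro eq_matI) (auto simp: mult.assoc[symmetric])
  have AH: "A * H = inverse (?d r) \<cdot>\<^sub>m (adj_sum H r * H)"
    unfolding A_def using dim by (simp add: smult_mult_mat)
  \<comment> \<open>The scalar can be pulled out on either side because it is real.\<close>
  have comm: "A * H = H * A"
  proof -
    have "H * A = inverse (?d r) \<cdot>\<^sub>m (H * adj_sum H r)"
      unfolding A_def using dim by (simp add: mult_smult_real_mat[OF real])
    then show ?thesis unfolding AH adj_sum_commute[OF H(2)] by (rule sym)
  qed
  have c: "A \<in> carrier_mat n n" unfolding A_def using dim by auto
  have "?d r \<cdot>\<^sub>m H = (?d r \<cdot>\<^sub>m 1\<^sub>m n) * H" using dim by (simp add: smult_mult_mat)
  also have "\<dots> = adj_sum H (Suc r) * H + adj_sum H r * H * H"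
    unfolding rec by (rule add_mult_distrib_mat[of _ n n]) (use dim in auto)
  also have "\<dots> = adj_sum H r * H * H" unfolding adjH using dim by (intro eq_matI) auto
  finally have dH: "?d r \<cdot>\<^sub>m H = adj_sum H r * H * H" .
  have "H * A * H = inverse (?d r) \<cdot>\<^sub>m (adj_sum H r * H * H)"
    unfolding comm[symmetric] AH using dim by (simp add: smult_mult_mat)
  also have "\<dots> = H" unfolding dH[symmetric] inv ..
  finally have HAH: "H * A * H = H" .
  have "mat_trace (A * H) = inverse (?d r) * mat_trace (adj_sum H r * H)"
    unfolding AH mat_trace_def using dim by (simp add: sum_distrib_left)
  also have "\<dots> = inverse (?d r) * (of_nat r * ?d r)"
    using trace_adj_sum_mult[OF H(2), of r] r dim by simp
  also have "\<dots> = of_nat r"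
    using r(1) by (simp add: mult_of_nat_commute mult.assoc[symmetric])
  finally have tr: "mat_trace (A * H) = of_nat r" .
  have "A * H = 1\<^sub>m n" if "r = n"
  proof -
    have "?d r \<cdot>\<^sub>m 1\<^sub>m n = adj_sum H r * H"
      unfolding rec using that adj_sum_gt[of H "Suc n"] dim by (intro eq_matI) auto
    then show ?thesis unfolding AH by (metis inv)
  qed
  then show ?thesis using that[OF r(2,1) adjH c comm HAH tr] by blast
qed

section \<open>The rank as the trace of an idempotent\<close>

definition lin_comb :: "nat \<Rightarrow> 'a :: semiring_0 vec list \<Rightarrow> (nat \<Rightarrow> 'a) \<Rightarrow> 'a vec" where
  "lin_comb n bs x = vec n (\<lambda>i. \<Sum>k<length bs. bs ! k $ i * x k)"

lemma mat_of_cols_mult_vec: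
  assumes "c \<in> carrier_vec (length bs)"
  shows "mat_of_cols n bs *\<^sub>v c = lin_comb n bs (($) c)"
  using assms by (intro eq_vecI)
    (auto simp: lin_comb_def scalar_prod_def mat_of_cols_index atLeast0LessThan)

lemma mat_of_cols_mult_vec_of_fun:
  "mat_of_cols n bs *\<^sub>v vec (length bs) x = lin_comb n bs x"
  by (subst mat_of_cols_mult_vec) (auto simp: lin_comb_def)

lemma right_col_space_mat_of_cols: "right_col_space (mat_of_cols n bs) = range (lin_comb n bs)"
  unfolding right_col_space_def
proof (intro equalityI subsetI)
  fix v assume "v \<in> {mat_of_cols n bs *\<^sub>v c | c. c \<in> carrier_vec (dim_col (mat_of_cols n bs))}"
  then obtain c where "v = mat_of_cols n bs *\<^sub>v c" "c \<in> carrier_vec (length bs)" by auto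
  then show "v \<in> range (lin_comb n bs)" using mat_of_cols_mult_vec by blast
next
  fix v assume "v \<in> range (lin_comb n bs)"
  then obtain x where "v = lin_comb n bs x" by blast
  then have "v = mat_of_cols n bs *\<^sub>v vec (length bs) x" by (simp only: mat_of_cols_mult_vec_of_fun)
  then show "v \<in> {mat_of_cols n bs *\<^sub>v c | c. c \<in> carrier_vec (dim_col (mat_of_cols n bs))}"
    by auto
qed

lemma right_indep_iff:
  "right_indep n bs \<longleftrightarrow> (\<forall>x. lin_comb n bs x = 0\<^sub>v n \<longrightarrow> (\<forall>k<length bs. x k = 0))"
proof
  assume ind: "right_indep n bs"
  show "\<forall>x. lin_comb n bs x = 0\<^sub>v n \<longrightarrow> (\<forall>k<length bs. x k = 0)"
  proof (intro allI impI)
    fix x k assume "lin_comb n bs x = 0\<^sub>v n" and k: "k < length bs"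
    then have "mat_of_cols n bs *\<^sub>v vec (length bs) x = 0\<^sub>v n" by (simp only: mat_of_cols_mult_vec_of_fun)
    then have "vec (length bs) x = 0\<^sub>v (length bs)" using ind unfolding right_indep_def by simp
    then have "vec (length bs) x $ k = 0" using k by simp
    then show "x k = 0" using k by simp
  qed
next
  assume R: "\<forall>x. lin_comb n bs x = 0\<^sub>v n \<longrightarrow> (\<forall>k<length bs. x k = 0)"
  show "right_indep n bs" unfolding right_indep_def
  proof (intro ballI impI)
    fix c assume c: "c \<in> carrier_vec (length bs)" and "mat_of_cols n bs *\<^sub>v c = 0\<^sub>v n"
    then have "lin_comb n bs (($) c) = 0\<^sub>v n" by (simp only: mat_of_cols_mult_vec)
    then have "\<forall>k<length bs. c $ k = 0" using R by blast
    then show "c = 0\<^sub>v (length bs)" using c by (intro eq_vecI) auto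
  qed
qed

lemma lin_comb_Cons:
  "lin_comb n (v # bs) x = vec n (\<lambda>i. v $ i * x 0 + lin_comb n bs (\<lambda>k. x (Suc k)) $ i)"
  by (rule eq_vecI) (simp_all add: lin_comb_def sum.lessThan_Suc_shift del: sum.lessThan_Suc)

lemma lin_comb_add_mult:
  "lin_comb n bs (\<lambda>k. x k * a + y k) = vec n (\<lambda>i. lin_comb n bs x $ i * (a :: 'a :: ring) + lin_comb n bs y $ i)"
  by (rule eq_vecI) (simp_all add: lin_comb_def distrib_left sum.distrib sum_distrib_right mult.assoc)

text \<open>A vector is prepended to the basis exactly if it is no combination of the vectors chosen before.\<close>

lemma right_basis_exists:
  fixes vs :: "'a :: division_ring vec list"
  assumes "set vs \<subseteq> carrier_vec n"
  shows "\<exists>bs. right_basis n (right_col_space (mat_of_cols n vs)) bs"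
  using assms
proof (induction vs)
  case Nil
  have "right_basis n (right_col_space (mat_of_cols n [])) ([] :: 'a vec list)"
    by (simp add: right_basis_def right_indep_iff)
  then show ?case by blast
next
  case (Cons v vs)
  then obtain bs where bs: "set bs \<subseteq> carrier_vec n" "right_indep n bs"
    "range (lin_comb n bs) = range (lin_comb n vs)"
    by (auto simp: right_basis_def right_col_space_mat_of_cols)
  have v: "v \<in> carrier_vec n" using Cons.prems by simp
  have cons: "range (lin_comb n (v # bs)) = range (lin_comb n (v # vs))"
  proof -
    have "range (lin_comb n (v # us)) = {vec n (\<lambda>i. v $ i * a + w $ i) | a w. w \<in> range (lin_comb n us)}" for us
    proof (intro equalityI subsetI)
      fix u assume "u \<in> range (lin_comb n (v # us))"
      then show "u \<in> {vec n (\<lambda>i. v $ i * a + w $ i) | a w. w \<in> range (lin_comb n us)}"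
        unfolding lin_comb_Cons by blast
    next
      fix u assume "u \<in> {vec n (\<lambda>i. v $ i * a + w $ i) | a w. w \<in> range (lin_comb n us)}"
      then obtain a y where u: "u = vec n (\<lambda>i. v $ i * a + lin_comb n us y $ i)" by blast
      have "u = lin_comb n (v # us) (\<lambda>k. case k of 0 \<Rightarrow> a | Suc k \<Rightarrow> y k)"
        unfolding u lin_comb_Cons by simp
      then show "u \<in> range (lin_comb n (v # us))" by blast
    qed
    then show ?thesis using bs(3) by simp
  qed
  show ?case
  proof (cases "v \<in> range (lin_comb n bs)")
    case True
    then obtain z where z: "v = lin_comb n bs z" by blast
    have "range (lin_comb n (v # bs)) = range (lin_comb n bs)"
    proof (intro equalityI subsetI)
      fix u assume "u \<in> range (lin_comb n (v # bs))"
      then obtain x where "u = vec n (\<lambda>i. lin_comb n bs z $ i * x 0 + lin_comb n bs (\<lambda>k. x (Suc k)) $ i)"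
        unfolding lin_comb_Cons z by blast
      then have "u = lin_comb n bs (\<lambda>k. z k * x 0 + x (Suc k))" by (simp only: lin_comb_add_mult)
      then show "u \<in> range (lin_comb n bs)" by blast
    next
      fix u assume "u \<in> range (lin_comb n bs)"
      then obtain y where u: "u = lin_comb n bs y" by blast
      have "u = lin_comb n (v # bs) (\<lambda>k. case k of 0 \<Rightarrow> 0 | Suc k \<Rightarrow> y k)"
        unfolding u lin_comb_Cons by (intro eq_vecI) (simp_all add: lin_comb_def)
      then show "u \<in> range (lin_comb n (v # bs))" by blast
    qed
    then have "right_basis n (right_col_space (mat_of_cols n (v # vs))) bs"
      using bs cons by (simp add: right_basis_def right_col_space_mat_of_cols)
    then show ?thesis by blast
  next
    case False
    have "right_indep n (v # bs)" unfolding right_indep_iff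
    proof (intro allI impI)
      fix x k assume x: "lin_comb n (v # bs) x = 0\<^sub>v n" and k: "k < length (v # bs)"
      have ent: "v $ i * x 0 + lin_comb n bs (\<lambda>k. x (Suc k)) $ i = 0" if "i < n" for i
        using arg_cong[OF x, of "\<lambda>u. u $ i"] that unfolding lin_comb_Cons by simp
      have x0: "x 0 = 0"
      proof (rule ccontr)
        assume nz: "x 0 \<noteq> 0"
        have "v = lin_comb n bs (\<lambda>k. x (Suc k) * (- inverse (x 0)) + 0)"
        proof (rule eq_vecI)
          fix i assume "i < dim_vec (lin_comb n bs (\<lambda>k. x (Suc k) * (- inverse (x 0)) + 0))"
          then have i: "i < n" by (simp add: lin_comb_def)
          have "v $ i * x 0 = - lin_comb n bs (\<lambda>k. x (Suc k)) $ i"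
            using ent[OF i] by (simp add: eq_neg_iff_add_eq_0)
          then have "v $ i * x 0 * inverse (x 0) = - lin_comb n bs (\<lambda>k. x (Suc k)) $ i * inverse (x 0)"
            by simp
          then have "v $ i = - lin_comb n bs (\<lambda>k. x (Suc k)) $ i * inverse (x 0)"
            using nz by (simp add: mult.assoc)
          moreover have "lin_comb n bs (\<lambda>_. 0) $ i = 0" using i by (simp add: lin_comb_def)
          ultimately show "v $ i = lin_comb n bs (\<lambda>k. x (Suc k) * (- inverse (x 0)) + 0) $ i"
            unfolding lin_comb_add_mult using i by simp
        qed (use v in \<open>auto simp: lin_comb_def\<close>)
        then show False using False by blast
      qed
      have "lin_comb n bs (\<lambda>k. x (Suc k)) = 0\<^sub>v n"
        using ent x0 by (intro eq_vecI) (auto simp: lin_comb_def)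
      then have "\<forall>k<length bs. x (Suc k) = 0" using bs(2) unfolding right_indep_iff by blast
      then show "x k = 0" using k x0 by (cases k) auto
    qed
    then have "right_basis n (right_col_space (mat_of_cols n (v # vs))) (v # bs)"
      using bs(1) v cons by (simp add: right_basis_def right_col_space_mat_of_cols)
    then show ?thesis by blast
  qed
qed

text \<open>Let the columns of \<open>B\<close> be the basis.  Then \<open>P = B C\<close> for some \<open>C\<close>, and \<open>P B = B\<close> gives
\<open>B (C B) = B\<close>, so \<open>C B\<close> is the identity by independence.  Its size is read off from
\<open>Re tr (B C) = Re tr (C B)\<close>.\<close>

lemma right_basis_length_idempotent:
  fixes P :: "quat mat"
  assumes P: "P \<in> carrier_mat n n" "P * P = P" and bs: "right_basis n (right_col_space P) bs"
  shows "real (length bs) = qre (mat_trace P)"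
proof -
  let ?d = "length bs"
  define B where "B = mat_of_cols n bs"
  have B: "B \<in> carrier_mat n ?d" unfolding B_def by simp
  have bs': "set bs \<subseteq> carrier_vec n" "right_indep n bs" "right_col_space B = right_col_space P"
    using bs by (auto simp: right_basis_def B_def)
  have "\<exists>c\<in>carrier_vec ?d. col P j = B *\<^sub>v c" if "j < n" for j
  proof -
    have "P *\<^sub>v unit_vec n j = col P j" using P that by (intro eq_vecI) auto
    then have "col P j \<in> right_col_space P"
      unfolding right_col_space_def using P by (auto intro!: exI[of _ "unit_vec n j"])
    then have "col P j \<in> right_col_space B" by (simp only: bs'(3))
    then show ?thesis unfolding right_col_space_def using B by auto
  qed
  then obtain c where c: "\<And>j. j < n \<Longrightarrow> c j \<in> carrier_vec ?d" "\<And>j. j < n \<Longrightarrow> col P j = B *\<^sub>v c j"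
    by metis
  define C where "C = mat_of_cols ?d (map c [0..<n])"
  have C: "C \<in> carrier_mat ?d n" unfolding C_def by (metis diff_zero length_map length_upt mat_of_cols_carrier(1))
  have colC: "col C j = c j" if "j < n" for j
    unfolding C_def using c(1)[OF that] that by (subst col_mat_of_cols) simp_all
  have BC: "B * C = P"
  proof (rule mat_col_eqI)
    fix j assume "j < dim_col P"
    then have j: "j < n" using P by simp
    show "col (B * C) j = col P j" using c(2)[OF j] colC[OF j] col_mult2[OF B C j] by simp
  qed (use B C P in auto)
  have PB: "P * B = B"
  proof (rule mat_col_eqI)
    fix k assume "k < dim_col B"
    then have k: "k < ?d" using B by simp
    have "B *\<^sub>v unit_vec ?d k = col B k" using B k by (intro eq_vecI) auto
    then have "col B k \<in> right_col_space B"
      unfolding right_col_space_def using B by (auto intro!: exI[of _ "unit_vec ?d k"])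
    then have "col B k \<in> right_col_space P" by (simp only: bs'(3))
    then obtain y where y: "y \<in> carrier_vec n" "col B k = P *\<^sub>v y"
      unfolding right_col_space_def using P by auto
    have "P *\<^sub>v (P *\<^sub>v y) = (P * P) *\<^sub>v y" using P(1) y(1) by (simp add: assoc_mult_mat_vec[of _ n n])
    then show "col (P * B) k = col B k" unfolding col_mult2[OF P(1) B k] y(2) P(2) .
  qed (use P B in auto)
  have CB: "C * B = 1\<^sub>m ?d"
  proof (rule eq_matI)
    fix i k assume "i < dim_row (1\<^sub>m ?d :: quat mat)" "k < dim_col (1\<^sub>m ?d :: quat mat)"
    then have ik: "i < ?d" "k < ?d" by auto
    let ?x = "\<lambda>l. (C * B) $$ (l, k) - (if l = k then 1 else 0)"
    have BCB: "B * (C * B) = B" using BC PB B C by (metis assoc_mult_mat)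
    have "lin_comb n bs ?x = 0\<^sub>v n"
    proof (rule eq_vecI)
      fix j assume "j < dim_vec (0\<^sub>v n :: quat vec)"
      then have j: "j < n" by simp
      have Bjl: "bs ! l $ j = B $$ (j, l)" if "l < ?d" for l
        unfolding B_def using that j by (simp add: mat_of_cols_index)
      have "lin_comb n bs ?x $ j = (\<Sum>l<?d. B $$ (j, l) * (C * B) $$ (l, k))
          - (\<Sum>l<?d. B $$ (j, l) * (if l = k then 1 else 0))"
        using j by (simp add: lin_comb_def Bjl right_diff_distrib sum_subtractf)
      also have "(\<Sum>l<?d. B $$ (j, l) * (C * B) $$ (l, k)) = (B * (C * B)) $$ (j, k)"
        using B C j ik by (simp add: scalar_prod_def atLeast0LessThan)
      also have "(\<Sum>l<?d. B $$ (j, l) * (if l = k then 1 else 0)) = B $$ (j, k)"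
        using ik by (simp add: if_distrib[of "\<lambda>z. _ * z"] cong: if_cong)
      finally show "lin_comb n bs ?x $ j = 0\<^sub>v n $ j" unfolding BCB using j by simp
    qed (simp add: lin_comb_def)
    then have "?x i = 0" using bs'(2) ik unfolding right_indep_iff by blast
    then show "(C * B) $$ (i, k) = 1\<^sub>m ?d $$ (i, k)" using ik by simp
  qed (use B C in auto)
  have "qre (mat_trace P) = qre (mat_trace (C * B))"
    unfolding BC[symmetric] by (rule qre_trace_mult_commute[OF B C])
  also have "\<dots> = real ?d" unfolding CB by (simp add: mat_trace_def qre_sum)
  finally show ?thesis by simp
qed

lemma right_rank_eq_trace:
  fixes P M :: "quat mat"
  assumes P: "P \<in> carrier_mat n n" "P * P = P"
    and M: "dim_row M = n" "right_col_space M = right_col_space P"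
    and tr: "qre (mat_trace P) = real s"
  shows "right_rank M = s"
proof -
  have "mat_of_cols n (cols P) = P" using P(1) mat_of_cols_cols[of P] by simp
  then obtain bs where bs: "right_basis n (right_col_space P) bs"
    using right_basis_exists[of "cols P" n] cols_dim[of P] P(1) by auto
  show ?thesis unfolding right_rank_def right_dim_def M
  proof (rule the_equality)
    show "\<exists>bs. right_basis n (right_col_space P) bs \<and> length bs = s"
      using bs right_basis_length_idempotent[OF P bs] tr by auto
  next
    fix d assume "\<exists>bs. right_basis n (right_col_space P) bs \<and> length bs = d"
    then show "d = s" using right_basis_length_idempotent[OF P] tr by auto
  qed
qed

lemma right_col_space_mult_subset:
  assumes "dim_col A = dim_row B"
  shows "right_col_space (A * B) \<subseteq> right_col_space A"
proof
  fix v assume "v \<in> right_col_space (A * B)"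
  then obtain c where c: "c \<in> carrier_vec (dim_col B)" "v = (A * B) *\<^sub>v c"
    unfolding right_col_space_def by auto
  have "v = A *\<^sub>v (B *\<^sub>v c)"
    unfolding c(2) by (rule assoc_mult_mat_vec[OF carrier_matI[OF refl assms] carrier_matI[OF refl refl] c(1)])
  moreover have "B *\<^sub>v c \<in> carrier_vec (dim_col A)"
    by (rule carrier_vecI) (simp only: dim_mult_mat_vec assms)
  ultimately show "v \<in> right_col_space A"
    unfolding right_col_space_def by (intro CollectI exI[of _ "B *\<^sub>v c"] conjI)
qed

section \<open>Principal minors of a Hermitian matrix\<close>

text \<open>The row determinants are conjugates of column determinants of the same Hermitian matrix, so all
of them have the same real value.  For \<open>r = 0\<close> there would be no row and \<open>hdet\<close> would be arbitrary.\<close>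

lemma hdet_principal_submatrix:
  fixes H :: "quat mat"
  assumes H: "hermitian_mat H" "dim_row H = n" and b: "b \<in> index_sets r n" and r: "1 \<le> r"
  shows "hdet (principal_submatrix H b) = det_on (entry H) b"
proof -
  interpret hermitian_entries "entry H" by (rule hermitian_entries_entry[OF H(1)])
  let ?N = "principal_submatrix H b"
  have c: "H \<in> carrier_mat n n" using hermitian_mat_square[OF H(1)] H(2) by auto
  have bb: "b \<subseteq> {0..<n}" "card b = r" using b by (auto simp: index_sets_def)
  have fb: "finite b" using b by (rule finite_mem_index_sets)
  note N = principal_submatrix_carrier[OF c bb(1), unfolded bb(2)]
  have pin: "pick b x \<in> b" if "x < r" for x using pick_in_set_le[of x b] that bb(2) by simp
  have pn: "pick b x < n" if "x < r" for x using pin[OF that] bb(1) by auto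
  have herm_N: "conj_transpose ?N = ?N"
    using N(1) by (intro eq_matI) (auto simp: N(2) hermitian_mat_index[OF H(1)] H(2) pn)
  have cd: "cdet x ?N = det_on (entry H) b" if x: "x < r" for x
  proof -
    have "cdet x ?N = cdet_on (\<lambda>x y. H $$ (x, y)) (b - {pick b x}) (pick b x) (\<lambda>a. H $$ (a, pick b x))"
      using cdet_principal_submatrix[OF c bb(1)] x bb(2) by simp
    also have "\<dots> = cdet_on (entry H) (b - {pick b x}) (pick b x) (\<lambda>a. entry H a (pick b x))"
    proof (rule cdet_on_cong)
      show "finite (b - {pick b x})" using fb by simp
      have lt: "a < n" if "a \<in> insert (pick b x) (b - {pick b x})" for a
        using that pn[OF x] bb(1) by auto
      show "H $$ (a, d) = entry H a d"
        if "a \<in> insert (pick b x) (b - {pick b x})" "d \<in> b - {pick b x}" for a d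
        using lt[of a] lt[of d] that by (simp add: entry_def H(2))
      show "H $$ (a, pick b x) = entry H a (pick b x)"
        if "a \<in> insert (pick b x) (b - {pick b x})" for a
        using lt[OF that] pn[OF x] by (simp add: entry_def H(2))
    qed
    also have "\<dots> = det_on (entry H) b" by (rule det_on_eq_walk[OF fb pin[OF x], symmetric])
    finally show ?thesis .
  qed
  have rd: "rdet x ?N = det_on (entry H) b" if x: "x < r" for x
    using rdet_conj_transpose[OF N(1) x] unfolding herm_N cd[OF x]
    by (simp add: hermitian_cdet_on(1)[OF fb])
  have dimN: "dim_row ?N = r" using N(1) by auto
  show ?thesis unfolding hdet_def dimN
  proof (rule the_equality)
    show "\<forall>i<r. rdet i ?N = det_on (entry H) b \<and> cdet i ?N = det_on (entry H) b"
      using cd rd by blast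
  next
    fix d assume "\<forall>i<r. rdet i ?N = d \<and> cdet i ?N = d"
    then have "cdet 0 ?N = d" using r by simp
    then show "d = det_on (entry H) b" using cd[of 0] r by simp
  qed
qed

lemma cdet_principal_replace_col:
  fixes H :: "'a :: ring_1 mat"
  assumes H: "H \<in> carrier_mat n n" and b: "b \<in> index_sets_at r n i"
  shows "cdet_principal i (replace_col H v i) b = cdet_on (entry H) (b - {i}) i (($) v)"
proof -
  have bb: "b \<subseteq> {0..<n}" "i \<in> b" using b by (auto simp: index_sets_at_def index_sets_def)
  have d: "dim_row H = n" "dim_col H = n" using H by auto
  have R: "replace_col H v i \<in> carrier_mat n n" using d by (simp add: replace_col_def)
  have "cdet_principal i (replace_col H v i) b
      = cdet_on (\<lambda>x y. replace_col H v i $$ (x, y)) (b - {i}) i (\<lambda>x. replace_col H v i $$ (x, i))"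
    by (rule cdet_principal_eq_cdet_on[OF R bb])
  also have "\<dots> = cdet_on (entry H) (b - {i}) i (($) v)"
  proof (rule cdet_on_cong)
    show "finite (b - {i})" using finite_mem_index_sets_at[OF b] by simp
    have lt: "a < n" if "a \<in> insert i (b - {i})" for a using that bb by auto
    show "replace_col H v i $$ (x, y) = entry H x y" if "x \<in> insert i (b - {i})" "y \<in> b - {i}" for x y
      using lt[of x] lt[of y] that by (simp add: replace_col_def entry_def d)
    show "replace_col H v i $$ (x, i) = v $ x" if "x \<in> insert i (b - {i})" for x
      using lt[OF that] lt[of i] by (simp add: replace_col_def d)
  qed
  finally show ?thesis .
qed

section \<open>The weighted Drazin inverse\<close>

text \<open>Iterate \<open>Y = Y V Y = V Y\<^sup>2 = Y\<^sup>2 V\<close>.\<close>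

lemma outer_inverse_factors:
  fixes V Y :: "'a :: ring_1 mat"
  assumes V: "V \<in> carrier_mat m m" and Y: "Y \<in> carrier_mat m m"
    and YVY: "Y * V * Y = Y" and VY: "V * Y = Y * V"
  obtains T T' where "T \<in> carrier_mat m m" "Y = V ^\<^sub>m j * T" "T' \<in> carrier_mat m m" "Y = T' * V ^\<^sub>m j"
proof -
  have d: "dim_row V = m" "dim_col V = m" "dim_row Y = m" "dim_col Y = m" using V Y by auto
  have "\<exists>T \<in> carrier_mat m m. Y = V ^\<^sub>m j * T"
  proof (induction j)
    case 0
    show ?case using Y d by (intro bexI[of _ Y]) auto
  next
    case (Suc j)
    then obtain T where T: "T \<in> carrier_mat m m" "Y = V ^\<^sub>m j * T" by blast
    have dT: "dim_row T = m" "dim_col T = m" using T by auto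
    have "Y = V * Y * Y" using YVY VY by simp
    also have "\<dots> = V * (V ^\<^sub>m j * T) * Y" by (simp only: T(2)[symmetric])
    also have "\<dots> = (V * V ^\<^sub>m j) * (T * Y)" using d dT by (simp add: mult_mat_assoc del: assoc_mult_mat)
    finally have "Y = V ^\<^sub>m Suc j * (T * Y)" unfolding pow_mat_Suc_left[OF V] .
    then show ?case using T Y by (intro bexI[of _ "T * Y"]) auto
  qed
  moreover have "\<exists>T \<in> carrier_mat m m. Y = T * V ^\<^sub>m j"
  proof (induction j)
    case 0
    show ?case using Y d by (intro bexI[of _ Y]) auto
  next
    case (Suc j)
    then obtain T where T: "T \<in> carrier_mat m m" "Y = T * V ^\<^sub>m j" by blast
    have dT: "dim_row T = m" "dim_col T = m" using T by auto
    have "Y = Y * (Y * V)" using YVY VY d by (simp add: mult_mat_assoc del: assoc_mult_mat)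
    also have "\<dots> = Y * ((T * V ^\<^sub>m j) * V)" by (simp only: T(2)[symmetric])
    also have "\<dots> = (Y * T) * V ^\<^sub>m Suc j" using d dT by (simp add: mult_mat_assoc del: assoc_mult_mat)
    finally show ?case using T Y by (intro bexI[of _ "Y * T"]) auto
  qed
  ultimately show ?thesis using that by blast
qed

text \<open>For a solution \<open>X\<close>, the matrix \<open>Y = X W\<close> is an outer inverse of \<open>V = A W\<close> that commutes with \<open>V\<close> and
satisfies \<open>V\<^sup>k\<^sup>+\<^sup>1 Y = V\<^sup>k\<close>, just as \<open>Z\<close> does.  Such a matrix is unique, since \<open>Y = Y V Z = Z\<close>, and
\<open>X = Y V X = Y\<^sup>2 A\<close> is determined by it.\<close>

lemma wdrazin_eq:
  fixes A W :: "'a :: division_ring mat"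
  assumes A: "A \<in> carrier_mat m n" and W: "W \<in> carrier_mat n m"
    and k: "k = max (mat_index (A * W)) (mat_index (W * A))"
    and Z: "Z \<in> carrier_mat m m"
    and ZVZ: "Z * (A * W) * Z = Z" and VZ: "(A * W) * Z = Z * (A * W)"
    and VkZ: "(A * W) ^\<^sub>m (k + 1) * Z = (A * W) ^\<^sub>m k"
  shows "wdrazin A W = Z * Z * A"
proof -
  define V where "V = A * W"
  have V: "V \<in> carrier_mat m m" using A W by (simp add: V_def)
  have d: "dim_row A = m" "dim_col A = n" "dim_row W = n" "dim_col W = m"
    "dim_row V = m" "dim_col V = m" "dim_row Z = m" "dim_col Z = m" using A W V Z by auto
  note [simp] = d mult_mat_assoc
  note [simp del] = assoc_mult_mat
  note VZ = VZ[folded V_def] and ZVZ = ZVZ[folded V_def] and VkZ = VkZ[folded V_def]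
  have AW: "A * (W * B) = V * B" if "dim_row B = m" for B
    using that by (simp add: V_def)
  have e1: "Z * (V * (Z * B)) = Z * B" if "dim_row B = m" for B
    using arg_cong[OF ZVZ, of "\<lambda>M. M * B"] that by simp
  have e2: "V * (Z * B) = Z * (V * B)" if "dim_row B = m" for B
    using arg_cong[OF VZ, of "\<lambda>M. M * B"] that by simp
  have e3: "V * (Z * (Z * B)) = Z * B" if "dim_row B = m" for B
    using e1[OF that] e2[of "Z * B"] that by simp
  have e4: "Z * (Z * (V * B)) = Z * B" if "dim_row B = m" for B
    using e1[OF that] e2[OF that] that by simp
  have def: "is_wdrazin A W X \<longleftrightarrow> X \<in> carrier_mat m n \<and>
      V ^\<^sub>m (k + 1) * X * W = V ^\<^sub>m k \<and> X * W * A * W * X = X \<and> A * W * X = X * W * A" for X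
    unfolding is_wdrazin_def Let_def k[symmetric] d by (simp only: V_def)
  show ?thesis unfolding wdrazin_def
  proof (rule the_equality)
    show "is_wdrazin A W (Z * Z * A)" unfolding def
    proof (intro conjI)
      show "Z * Z * A \<in> carrier_mat m n" using A Z by simp
      have "V ^\<^sub>m (k + 1) * (Z * Z * A) * W = (V ^\<^sub>m (k + 1) * Z) * (Z * V)"
        by (simp add: V_def[symmetric] del: pow_mat.simps)
      also have "\<dots> = V ^\<^sub>m k * (V * Z)" by (simp only: VkZ VZ)
      also have "\<dots> = V ^\<^sub>m (k + 1) * Z" by simp
      finally show "V ^\<^sub>m (k + 1) * (Z * Z * A) * W = V ^\<^sub>m k" unfolding VkZ .
      show "Z * Z * A * W * A * W * (Z * Z * A) = Z * Z * A" by (simp add: AW e3 e1)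
      show "A * W * (Z * Z * A) = Z * Z * A * W * A" by (simp add: AW e3 e4)
    qed
  next
    fix X assume "is_wdrazin A W X"
    then have X: "X \<in> carrier_mat m n" "V ^\<^sub>m (k + 1) * X * W = V ^\<^sub>m k"
      "X * W * A * W * X = X" "A * W * X = X * W * A" unfolding def by auto
    have dX: "dim_row X = m" "dim_col X = n" using X(1) by auto
    note [simp] = dX
    define Y where "Y = X * W"
    have Y: "Y \<in> carrier_mat m m" using X(1) W by (simp add: Y_def)
    have dY: "dim_row Y = m" "dim_col Y = m" using Y by auto
    have y1: "V ^\<^sub>m (k + 1) * Y = V ^\<^sub>m k" using X(2) by (simp add: Y_def del: pow_mat.simps)
    have y2: "Y * V * Y = Y"
      using arg_cong[OF X(3), of "\<lambda>M. M * W"] by (simp add: Y_def V_def)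
    have y3: "V * Y = Y * V"
      using arg_cong[OF X(4), of "\<lambda>M. M * W"] by (simp add: Y_def V_def)
    have Yk: "Y * V ^\<^sub>m (k + 1) = V ^\<^sub>m k"
      unfolding pow_mat_commute[OF V Y y3[symmetric]] by (rule y1)
    obtain T where T: "T \<in> carrier_mat m m" "Y = T * V ^\<^sub>m k"
      by (rule outer_inverse_factors[OF V Y y2 y3])
    obtain S where S: "S \<in> carrier_mat m m" "Z = V ^\<^sub>m k * S"
      by (rule outer_inverse_factors[OF V Z ZVZ VZ])
    have dTS: "dim_row T = m" "dim_col T = m" "dim_row S = m" "dim_col S = m" using T(1) S(1) by auto
    \<comment> \<open>\<open>Y V Z\<close> is reduced to \<open>Y\<close> through \<open>Y = T V\<^sup>k\<close>, and to \<open>Z\<close> through \<open>Z = V\<^sup>k S\<close>.\<close>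
    have "Y * (V * Z) = T * (V ^\<^sub>m (k + 1) * Z)"
      by (subst T(2)) (simp add: dTS)
    also have "\<dots> = Y" unfolding VkZ T(2) ..
    finally have 1: "Y * (V * Z) = Y" .
    have "Y * (V * Z) = (Y * V ^\<^sub>m (k + 1)) * S"
      using pow_mat_Suc_left[OF V, of k] by (subst S(2)) (simp add: dTS dY del: pow_mat.simps)
    also have "\<dots> = Z" unfolding Yk S(2) ..
    finally have YZ: "Y = Z" using 1 by simp
    have "X = Y * (A * W * X)" using X(3) by (simp add: Y_def)
    also have "\<dots> = Y * (Y * A)" unfolding X(4) by (simp add: Y_def)
    finally show "X = Z * Z * A" unfolding YZ by simp
  qed
qed

text \<open>The inner inverse \<open>B\<close> of \<open>V\<close> yields the group inverse \<open>B V B\<close>, and \<open>V\<^sup>2 Z = V\<close> gives the last equation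
for \<open>k > 0\<close>.  For \<open>k = 0\<close> that equation says that \<open>V\<close> is invertible; this is where the ranks of \<open>V\<close> and of
the identity matrix are compared.\<close>

lemma hermitian_group_inverse:
  fixes V :: "quat mat"
  assumes V: "V \<in> carrier_mat m m" "hermitian_mat V"
    and rk: "right_rank (V ^\<^sub>m (k + 1)) = right_rank (V ^\<^sub>m k)"
  obtains Z where "Z \<in> carrier_mat m m" "Z * V * Z = Z" "V * Z = Z * V"
    "V ^\<^sub>m (k + 1) * Z = V ^\<^sub>m k"
proof -
  obtain r B where r: "B \<in> carrier_mat m m" "B * V = V * B" "V * B * V = V"
    "mat_trace (B * V) = of_nat r" "r = m \<Longrightarrow> B * V = 1\<^sub>m m"
    using hermitian_inner_inverse[OF V] by metis
  have d: "dim_row V = m" "dim_col V = m" "dim_row B = m" "dim_col B = m" using V r by auto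
  note [simp] = d mult_mat_assoc
  note [simp del] = assoc_mult_mat
  \<comment> \<open>\<open>B\<close> is only an inner inverse; \<open>B V B\<close> is an outer inverse as well.\<close>
  define Z where "Z = B * V * B"
  have VBV: "V * (B * (V * M)) = V * M" if "dim_row M = m" for M
    using arg_cong[OF r(3), of "\<lambda>N. N * M"] that by simp
  have Z: "Z \<in> carrier_mat m m" using V r by (simp add: Z_def)
  have VZ: "V * Z = V * B" by (simp add: Z_def VBV)
  have ZV: "Z * V = B * V" using r(3) by (simp add: Z_def)
  have VZV: "V * (V * Z) = V" unfolding VZ using r(2,3) by simp
  have "Z * V * Z = B * (V * Z)" unfolding ZV using Z by simp
  also have "\<dots> = Z" unfolding VZ by (simp add: Z_def)
  finally have ZVZ: "Z * V * Z = Z" .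
  have comm: "V * Z = Z * V" unfolding VZ ZV r(2) ..
  have "V ^\<^sub>m (k + 1) * Z = V ^\<^sub>m k"
  proof (cases k)
    case 0
    have "right_rank V = r"
    proof (rule right_rank_eq_trace)
      show "B * V \<in> carrier_mat m m" using V r by simp
      show "B * V * (B * V) = B * V" using r(3) by simp
      have "V = (B * V) * V" using r(2,3) by simp
      then have "right_col_space V \<subseteq> right_col_space (B * V)"
        using right_col_space_mult_subset[of "B * V" V] by simp
      moreover have "right_col_space (B * V) \<subseteq> right_col_space V"
        unfolding r(2) by (rule right_col_space_mult_subset) simp
      ultimately show "right_col_space V = right_col_space (B * V)" ..
      show "qre (mat_trace (B * V)) = real r"
        unfolding r(4) by simp
    qed simp
    moreover have "right_rank (1\<^sub>m m :: quat mat) = m"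
      by (rule right_rank_eq_trace) (auto simp: mat_trace_def qre_sum)
    moreover have "right_rank V = right_rank (1\<^sub>m m :: quat mat)" using rk 0 by simp
    ultimately have "r = m" by simp
    then have "V * Z = 1\<^sub>m m" unfolding VZ r(2)[symmetric] by (rule r(5))
    then show ?thesis using 0 by simp
  next
    case (Suc j)
    have "V ^\<^sub>m (k + 1) * Z = V ^\<^sub>m j * (V * (V * Z))" using Suc Z by simp
    then show ?thesis unfolding VZV using Suc by simp
  qed
  then show ?thesis using that Z ZVZ comm by blast
qed

theorem theorem3p6:
  fixes A W :: "quat mat" and m n k r :: nat
  assumes "A \<in> carrier_mat m n"
    and "W \<in> carrier_mat n m"
    and "hermitian_mat (A * W)"
    and "k = max (mat_index (A * W)) (mat_index (W * A))"
    and "right_rank ((A * W) ^\<^sub>m (k + 1)) = r"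
    and "right_rank ((A * W) ^\<^sub>m k) = r"
    and "1 \<le> r"
  shows "\<forall>i < m. \<forall>j < n.
    wdrazin A W $$ (i, j) =
      (\<Sum>\<beta> \<in> index_sets_at r m i.
         cdet_principal i
           (replace_col ((A * W) ^\<^sub>m (k + 2)) (col ((A * W) ^\<^sub>m k * A) j) i) \<beta>)
      / (\<Sum>\<beta> \<in> index_sets r m. hdet (principal_submatrix ((A * W) ^\<^sub>m (k + 2)) \<beta>))"
proof -
  define V where "V = A * W"
  define H where "H = V ^\<^sub>m (k + 2)"
  have V: "V \<in> carrier_mat m m" "hermitian_mat V" using assms(1-3) by (simp_all add: V_def)
  have H: "H \<in> carrier_mat m m" "hermitian_mat H"
    using V by (simp_all add: H_def hermitian_mat_pow del: pow_mat.simps)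
  obtain Z where Z: "Z \<in> carrier_mat m m" "Z * V * Z = Z" "V * Z = Z * V"
    "V ^\<^sub>m (k + 1) * Z = V ^\<^sub>m k"
    using hermitian_group_inverse[OF V, of k] assms(5,6) unfolding V_def by metis
  have X: "wdrazin A W = Z * Z * A"
    using wdrazin_eq[OF assms(1,2,4)] Z unfolding V_def by blast
  obtain s B where s: "minor_sum (entry H) m s \<noteq> 0" "adj_sum H (Suc s) * H = 0\<^sub>m m m"
    "B \<in> carrier_mat m m" "B * H = H * B" "H * B * H = H" "mat_trace (B * H) = of_nat s"
    using hermitian_inner_inverse[OF H] by metis
  have d: "dim_row A = m" "dim_col A = n" "dim_row V = m" "dim_col V = m"
    "dim_row H = m" "dim_col H = m" "dim_row Z = m" "dim_col Z = m" "dim_row B = m" "dim_col B = m"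
    using assms(1) V H Z s by auto
  note [simp] = d mult_mat_assoc
  note [simp del] = assoc_mult_mat pow_mat.simps
  have HV: "H = V ^\<^sub>m (k + 1) * V" by (simp add: H_def pow_mat.simps)
  \<comment> \<open>\<open>V\<^sup>k\<^sup>+\<^sup>1 = H Z\<close> has the same column space as \<open>H\<close> and as the idempotent \<open>B H\<close>.\<close>
  have rs: "right_rank (V ^\<^sub>m (k + 1)) = s"
  proof (rule right_rank_eq_trace)
    have BHH: "B * H * H = H" unfolding s(4) by (rule s(5))
    show "B * H \<in> carrier_mat m m" using H s by simp
    show "B * H * (B * H) = B * H" using s(5) by simp
    have "V ^\<^sub>m (k + 1) = V ^\<^sub>m k * V" by (simp add: pow_mat.simps)
    also have "\<dots> = H * Z" unfolding Z(4)[symmetric] HV using Z(3) by simp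
    also have "\<dots> = (B * H) * (H * Z)"
      using arg_cong[OF BHH, of "\<lambda>M. M * Z"] by simp
    finally have "right_col_space (V ^\<^sub>m (k + 1)) \<subseteq> right_col_space (B * H)"
      using right_col_space_mult_subset[of "B * H" "H * Z"] by simp
    moreover have "B * H = (V ^\<^sub>m (k + 1) * V) * B" unfolding s(4) by (simp only: HV)
    then have "B * H = V ^\<^sub>m (k + 1) * (V * B)" by simp
    then have "right_col_space (B * H) \<subseteq> right_col_space (V ^\<^sub>m (k + 1))"
      using right_col_space_mult_subset[of "V ^\<^sub>m (k + 1)" "V * B"] by simp
    ultimately show "right_col_space (V ^\<^sub>m (k + 1)) = right_col_space (B * H)" ..
    show "qre (mat_trace (B * H)) = real s" unfolding s(6) by simp
  qed simp
  then have sr: "s = r" using assms(5) unfolding V_def by simp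
  interpret hermitian_entries "entry H" by (rule hermitian_entries_entry[OF H(2)])
  define c where "c = minor_sum (entry H) m r"
  have c0: "c \<noteq> 0" using s(1) unfolding c_def sr .
  have creal: "conjugate c = c" unfolding c_def by (rule minor_sum_real)
  \<comment> \<open>The columns of \<open>Z\<close>, and hence those of \<open>X = Z\<^sup>2 A\<close>, lie in the column space of \<open>H\<close>.\<close>
  obtain T where T: "T \<in> carrier_mat m m" "Z = H * T"
    unfolding H_def by (rule outer_inverse_factors[OF V(1) Z(1-3)])
  have dT: "dim_row T = m" "dim_col T = m" using T(1) by auto
  have "adj_sum H (Suc r) * (Z * Z * A) = (adj_sum H (Suc r) * H) * (T * (Z * A))"
    unfolding arg_cong[OF T(2), of "\<lambda>M. M * Z * A"] using dT by simp
  also have "\<dots> = 0\<^sub>m m n"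
    unfolding s(2)[unfolded sr] using dT by (intro eq_matI) (auto simp: scalar_prod_def)
  finally have adj0: "adj_sum H (Suc r) * (Z * Z * A) = 0\<^sub>m m n" .
  have "V * (Z * (Z * A)) = (Z * V * Z) * A" using arg_cong[OF Z(3), of "\<lambda>M. M * (Z * A)"] by simp
  then have "V ^\<^sub>m (k + 1) * (V * (Z * (Z * A))) = V ^\<^sub>m (k + 1) * Z * A" unfolding Z(2) by simp
  then have HX: "H * (Z * Z * A) = V ^\<^sub>m k * A" unfolding Z(4) HV by simp
  have carr: "adj_sum H (Suc r) \<in> carrier_mat m m" "adj_sum H r * H \<in> carrier_mat m m"
    "Z * Z * A \<in> carrier_mat m n"
    by (rule carrier_matI; simp)+
  have "c \<cdot>\<^sub>m (Z * Z * A) = (c \<cdot>\<^sub>m 1\<^sub>m m) * (Z * Z * A)" by (simp add: smult_mult_mat)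
  also have "\<dots> = adj_sum H (Suc r) * (Z * Z * A) + adj_sum H r * H * (Z * Z * A)"
    unfolding c_def adj_sum_rec[OF H(2), unfolded d]
    by (rule add_mult_distrib_mat[OF carr])
  also have "adj_sum H r * H * (Z * Z * A) = adj_sum H r * (V ^\<^sub>m k * A)"
    unfolding HX[symmetric] by simp
  finally have cX: "c \<cdot>\<^sub>m (Z * Z * A) = 0\<^sub>m m n + adj_sum H r * (V ^\<^sub>m k * A)" unfolding adj0 .
  have den: "(\<Sum>\<beta> \<in> index_sets r m. hdet (principal_submatrix H \<beta>)) = c"
    unfolding c_def minor_sum_def
    by (rule sum.cong[OF refl], rule hdet_principal_submatrix[OF H(2) d(5) _ assms(7)])
  show ?thesis unfolding V_def[symmetric] H_def[symmetric] X den
  proof (intro allI impI)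
    fix i j assume ij: "i < m" "j < n"
    have "(\<Sum>\<beta> \<in> index_sets_at r m i. cdet_principal i (replace_col H (col (V ^\<^sub>m k * A) j) i) \<beta>)
        = cdet_sum (entry H) m r i (($) (col (V ^\<^sub>m k * A) j))"
      unfolding cdet_sum_def
      by (rule sum.cong[OF refl], rule cdet_principal_replace_col[OF H(1)])
    also have "\<dots> = cdet_sum (entry H) m r i (\<lambda>x. (V ^\<^sub>m k * A) $$ (x, j))"
      by (rule cdet_sum_cong) (use ij in simp)
    also have "\<dots> = (adj_sum H r * (V ^\<^sub>m k * A)) $$ (i, j)"
      using adj_sum_mult_index[of "V ^\<^sub>m k * A" H i j r] ij by simp
    also have "\<dots> = (c \<cdot>\<^sub>m (Z * Z * A)) $$ (i, j)" unfolding cX using ij by simp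
    also have "\<dots> = (Z * Z * A) $$ (i, j) * c"
      using ij real_quat_commute[OF creal] by simp
    finally show "(Z * Z * A) $$ (i, j)
        = (\<Sum>\<beta> \<in> index_sets_at r m i. cdet_principal i (replace_col H (col (V ^\<^sub>m k * A) j) i) \<beta>) / c"
      using c0 by (simp add: divide_inverse mult.assoc del: mult_mat_assoc)
  qed
qed

end
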